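(* Suppose $2\le k_1$ and $2\le t\le\min\{k_2,d\}$. Then the set $F_\emptyset$ is a Gröbner basis for the ideal $I_\emptyset$ with respect to the term order $\prec$.
   Context: Let $k_1,k_2,d,t$ be integers as in the claim; $[n]=\{1,\dots,n\}$. Let $X=(x_{i(j,\ell)})$ be the $d\times k_1k_2$ matrix of indeterminates with rows $i\in[d]$ and columns $(j,\ell)\in[k_1]\times[k_2]$, and $\mathbb C[X]$ the polynomial ring over $\mathbb C$ in its entries. Put $C_i=[k_1]\times\{i\}$ for $i\in[k_2]$, and let $X_{C_i}$ be the submatrix of $X$ with columns in $C_i$. For a submatrix $Y$ of $X$, $F_r(Y)$ is the set of $r$-minors of $Y$ and $I_r(Y)$ the ideal of $\mathbb C[X]$ it generates. Define $F_\emptyset=F_t(X)\cup\bigcup_{i=1}^{k_2}F_2(X_{C_i})$ and $I_\emptyset=I_t(X)+\sum_{i=1}^{k_2}I_2(X_{C_i})$. The columns of $X$ are ordered $(1,1),(2,1),\dots,(k_1,1),(1,2),\dots,(k_1,2),\dots,(1,k_2),\dots,(k_1,k_2)$. The term order $\prec$ is the lexicographic order with respect to the variable order $x_{1(1,1)}>x_{2(1,1)}>\cdots>x_{d(1,1)}>x_{1(2,1)}>\cdots>x_{d(k_1,k_2)}$ (columns in the order $(1,1),(2,1),\dots,(k_1,1),(1,2),\dots,(k_1,2),\dots,(1,k_2),\dots,(k_1,k_2)$, and within each column by increasing row index). *)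

theory Defs
  imports
    Complex_Main
    "HOL-Library.Poly_Mapping"
    "HOL-Library.Set_Algebras"
    "HOL-Algebra.Ideal"
    "Jordan_Normal_Form.Determinant"
    "Jordan_Normal_Form.DL_Submatrix"
begin

section \<open>Polynomial rings and Groebner bases\<close>

text \<open>
  Monomials are finitely supported exponent vectors, and polynomials are finitely supported
  coefficient functions on monomials, with the convolution product of Poly_Mapping.
\<close>

type_synonym 'v monomial = "'v \<Rightarrow>\<^sub>0 nat"
type_synonym 'v cpoly = "'v monomial \<Rightarrow>\<^sub>0 complex"

definition Var :: "'v \<Rightarrow> 'v cpoly" where
  "Var v = Poly_Mapping.single (Poly_Mapping.single v 1) 1"

text \<open>
  The type of the variables is infinite in the application, so the polynomial ring in finitely
  many variables is a subring of the type of all polynomials.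
\<close>

definition poly_ring :: "'v set \<Rightarrow> 'v cpoly ring" where
  "poly_ring V = \<lparr>carrier = {p. \<forall>m\<in>Poly_Mapping.keys p. Poly_Mapping.keys m \<subseteq> V},
     monoid.mult = (*), one = 1, zero = 0, add = (+)\<rparr>"

text \<open>
  \<open>gt v w\<close> means that \<open>v\<close> is a bigger variable than \<open>w\<close>. Monomials are compared by the exponent
  of the biggest variable at which they differ.
\<close>

definition lex_less :: "('v \<Rightarrow> 'v \<Rightarrow> bool) \<Rightarrow> 'v monomial \<Rightarrow> 'v monomial \<Rightarrow> bool" where
  "lex_less gt m m' \<longleftrightarrow>
     (\<exists>v. Poly_Mapping.lookup m v < Poly_Mapping.lookup m' v \<and>
        (\<forall>w. gt w v \<longrightarrow> Poly_Mapping.lookup m w = Poly_Mapping.lookup m' w))"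

definition leading_monomial :: "('v monomial \<Rightarrow> 'v monomial \<Rightarrow> bool) \<Rightarrow> 'v cpoly \<Rightarrow> 'v monomial" where
  "leading_monomial lt p =
     (THE m. m \<in> Poly_Mapping.keys p \<and>
        (\<forall>m'\<in>Poly_Mapping.keys p. m' \<noteq> m \<longrightarrow> lt m' m))"

definition initial_ideal ::
    "'v set \<Rightarrow> ('v monomial \<Rightarrow> 'v monomial \<Rightarrow> bool) \<Rightarrow> 'v cpoly set \<Rightarrow> 'v cpoly set" where
  "initial_ideal V lt S =
     Idl\<^bsub>poly_ring V\<^esub> ((\<lambda>p. Poly_Mapping.single (leading_monomial lt p) 1) ` (S - {0}))"

definition is_groebner_basis ::
    "'v set \<Rightarrow> ('v monomial \<Rightarrow> 'v monomial \<Rightarrow> bool) \<Rightarrow> 'v cpoly set \<Rightarrow> 'v cpoly set \<Rightarrow> bool" where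
  "is_groebner_basis V lt G I \<longleftrightarrow>
     finite G \<and> G \<subseteq> I \<and> initial_ideal V lt G = initial_ideal V lt I"

section \<open>The generic matrix and its minors\<close>

text \<open>The variable with index \<open>(i, (j, l))\<close> is the entry in row \<open>i\<close> and column \<open>(j, l)\<close>.\<close>

type_synonym var = "nat \<times> (nat \<times> nat)"

definition vars :: "nat \<Rightarrow> nat \<Rightarrow> nat \<Rightarrow> var set" where
  "vars d k1 k2 = {1..d} \<times> ({1..k1} \<times> {1..k2})"

text \<open>
  Matrices are indexed from 0; \<open>column_label k1\<close> enumerates the column labels in the order
  \<open>(1,1), \<dots>, (k1,1), (1,2), \<dots>, (k1,2), \<dots>\<close>
\<close>

definition column_label :: "nat \<Rightarrow> nat \<Rightarrow> nat \<times> nat" where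
  "column_label k1 c = (c mod k1 + 1, c div k1 + 1)"

definition generic_matrix :: "nat \<Rightarrow> nat \<Rightarrow> nat \<Rightarrow> var cpoly mat" where
  "generic_matrix d k1 k2 = mat d (k1 * k2) (\<lambda>(i, c). Var (i + 1, column_label k1 c))"

definition block :: "nat \<Rightarrow> nat \<Rightarrow> (nat \<times> nat) set" where
  "block k1 i = {1..k1} \<times> {i}"

definition block_matrix :: "nat \<Rightarrow> nat \<Rightarrow> nat \<Rightarrow> nat \<Rightarrow> var cpoly mat" where
  "block_matrix d k1 k2 i =
     submatrix (generic_matrix d k1 k2) {..<d}
       {c. c < k1 * k2 \<and> column_label k1 c \<in> block k1 i}"

definition minors :: "nat \<Rightarrow> 'a::comm_ring_1 mat \<Rightarrow> 'a set" where
  "minors r Y = {det (submatrix Y A B) | A B.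
     A \<subseteq> {..<dim_row Y} \<and> card A = r \<and> B \<subseteq> {..<dim_col Y} \<and> card B = r}"

definition minor_ideal :: "var set \<Rightarrow> nat \<Rightarrow> var cpoly mat \<Rightarrow> var cpoly set" where
  "minor_ideal V r Y = Idl\<^bsub>poly_ring V\<^esub> (minors r Y)"

definition F_empty :: "nat \<Rightarrow> nat \<Rightarrow> nat \<Rightarrow> nat \<Rightarrow> var cpoly set" where
  "F_empty d k1 k2 t =
     minors t (generic_matrix d k1 k2) \<union> (\<Union>i\<in>{1..k2}. minors 2 (block_matrix d k1 k2 i))"

text \<open>Sums of ideals are elementwise sums of sets, as in Set_Algebras.\<close>

definition I_empty :: "nat \<Rightarrow> nat \<Rightarrow> nat \<Rightarrow> nat \<Rightarrow> var cpoly set" where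
  "I_empty d k1 k2 t =
     minor_ideal (vars d k1 k2) t (generic_matrix d k1 k2)
     + (\<Sum>i\<in>{1..k2}. minor_ideal (vars d k1 k2) 2 (block_matrix d k1 k2 i))"

fun var_gt :: "var \<Rightarrow> var \<Rightarrow> bool" where
  "var_gt (i, (j, l)) (i', (j', l')) \<longleftrightarrow>
     l < l' \<or> (l = l' \<and> (j < j' \<or> (j = j' \<and> i < i')))"

end

theory Submission
  imports Defs
begin

text \<open>
  The two initial ideals agree once the leading monomial \<open>m\<close> of every nonzero \<open>f\<close> in the ideal is
  divisible by the leading monomial of one of the given minors. The order is diagonal: the leading
  monomial of a minor is the product of its main diagonal. So if \<open>m\<close> were not divisible, then its
  set \<open>S\<close> of variables, seen as a set of positions in the matrix, would contain neither a strictly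
  south-east chain of length 2 inside a block nor one of length \<open>t\<close> through \<open>t\<close> different blocks.
  For such a set \<open>S\<close> one finds a point of the variety at which \<open>m\<close> dominates all other terms of
  \<open>f\<close>. But \<open>f\<close> vanishes there, which is the contradiction.

  The point is obtained by tropical means. Replace the lexicographic order by weights \<open>w\<close> of the
  variables that select the same leading monomial of \<open>f\<close>; these are supermodular as a function of
  row and column, that is, the excess of a row over the next one does not increase from left to
  right. If a set of positions contains no chain of length 2, then it is a part of a staircase that
  runs from the lower left to the upper right. Following the staircase one builds potentials \<open>p\<close> of
  the rows and \<open>q\<close> of the columns with \<open>p i + q c \<le> w i c\<close> everywhere and equality on the set: this
  is \<open>supermodular_potentials\<close>. It is used twice in \<open>tropical_point\<close>. Inside a block it splits the
  weights into a column part \<open>\<alpha>\<close> and a row part \<open>\<beta>\<close>; and since the differences of \<open>\<beta>\<close> between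
  consecutive rows are differences of \<open>w\<close> in some column of that block, \<open>\<beta>\<close> is again supermodular
  as a function of row and block. The rows and blocks that \<open>S\<close> meets form a set without chains of
  length \<open>t\<close>, hence a union of \<open>t - 1\<close> sets without chains of length 2 (\<open>antichain_levels\<close>), and
  each level gets its own potentials \<open>p s\<close>, \<open>q s\<close> for \<open>\<beta>\<close>.

  The matrix with entries \<open>\<Sum>s<t-1. exp (\<tau> * (p s i + q s l + \<alpha> (j, l)))\<close> has rank less than \<open>t\<close>,
  and each of its blocks has rank at most 1, so it lies in the variety (\<open>I_empty_vanish\<close>). Its
  entry at \<open>v\<close> is at most \<open>(t - 1) * exp (\<tau> * w v)\<close>, and on \<open>S\<close> at least \<open>exp (\<tau> * w v)\<close>. As \<open>\<tau>\<close>
  grows, the term of \<open>m\<close> outgrows all other terms of \<open>f\<close> (\<open>dominant_term_nonvanishing\<close>).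
\<close>

section \<open>Potentials of supermodular weights\<close>

text \<open>
  \<open>S\<close> lies on a staircase, and \<open>g r\<close> is the column in which the staircase steps from row \<open>r + 1\<close> up
  to row \<open>r\<close>: every element of \<open>S\<close> in a row up to \<open>r\<close> is weakly to the right of \<open>g r\<close>, every one
  below row \<open>r\<close> is weakly to the left. Along a vertical step the potential must change as \<open>w\<close> does
  in that column, which determines \<open>p\<close> up to a constant; \<open>q\<close> is then chosen as large as possible.
  For \<open>(i, c) \<in> S\<close> the minimum that defines \<open>q c\<close> is attained at row \<open>i\<close>, because supermodularity
  compares each step of \<open>p\<close> with the step of \<open>w\<close> in column \<open>c\<close>, and the comparison goes the right
  way on both sides of row \<open>i\<close>. The last conclusion lets the lemma be iterated.
\<close>

lemma supermodular_potentials: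
  fixes w :: "nat \<Rightarrow> nat \<Rightarrow> real"
  assumes "1 \<le> d" and C: "finite C" "C \<noteq> {}"
    and super: "\<And>r c c'. 1 \<le> r \<Longrightarrow> r < d \<Longrightarrow> c \<in> C \<Longrightarrow> c' \<in> C \<Longrightarrow> c \<le> c'
      \<Longrightarrow> w r c' - w (Suc r) c' \<le> w r c - w (Suc r) c"
    and S: "S \<subseteq> {1..d} \<times> C"
    and anti: "\<And>i c i' c'. (i, c) \<in> S \<Longrightarrow> (i', c') \<in> S \<Longrightarrow> i < i' \<Longrightarrow> c' \<le> c"
  shows "\<exists>p q. (\<forall>i\<in>{1..d}. \<forall>c\<in>C. p i + q c \<le> w i c) \<and>
    (\<forall>i c. (i, c) \<in> S \<longrightarrow> p i + q c = w i c) \<and>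
    (\<forall>r. 1 \<le> r \<and> r < d \<longrightarrow> (\<exists>c\<in>C. p r - p (Suc r) = w r c - w (Suc r) c))"
proof -
  \<comment> \<open>The column \<open>Min C\<close> only keeps the set nonempty from the last row that meets \<open>S\<close> onwards.\<close>
  define G where "G = (\<lambda>r. insert (Min C) {c. \<exists>i. (i, c) \<in> S \<and> r < i})"
  define g where "g = (\<lambda>r. Max (G r))"
  define p where "p = (\<lambda>i. \<Sum>r=i..<d. w r (g r) - w (Suc r) (g r))"
  define q where "q = (\<lambda>c. Min ((\<lambda>i. w i c - p i) ` {1..d}))"
  have G_sub: "G r \<subseteq> C" for r using S C by (auto simp: G_def)
  have G_fin: "finite (G r)" for r using finite_subset[OF G_sub C(1)] .
  have g_in: "g r \<in> C" for r
    using Max_in[OF G_fin, of r] G_sub[of r] by (auto simp: g_def G_def)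
  have g_ge: "c \<le> g r" if "(i, c) \<in> S" "r < i" for i c r
    unfolding g_def by (rule Max_ge[OF G_fin]) (use that in \<open>auto simp: G_def\<close>)
  have g_le: "g r \<le> c" if "(i, c) \<in> S" "i \<le> r" for i c r
    unfolding g_def
  proof (rule Max.boundedI[OF G_fin])
    show "G r \<noteq> {}" by (simp add: G_def)
    fix a assume "a \<in> G r"
    with that S C anti show "a \<le> c" by (fastforce simp: G_def)
  qed
  have p_step: "p r - p (Suc r) = w r (g r) - w (Suc r) (g r)" if "r < d" for r
    using that by (simp add: p_def sum.atLeast_Suc_lessThan)
  have tele: "f a - f b = (\<Sum>r=a..<b. f r - f (Suc r))" if "a \<le> b" for f :: "nat \<Rightarrow> real" and a b
    using sum_Suc_diff'[OF that, of "\<lambda>i. - f i"] by simp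
  have opt: "w i c - p i \<le> w i' c - p i'" if ic: "(i, c) \<in> S" and i': "i' \<in> {1..d}" for i c i'
  proof (cases "i \<le> i'")
    case True
    have "(\<Sum>r=i..<i'. w r c - w (Suc r) c) \<le> (\<Sum>r=i..<i'. p r - p (Suc r))"
    proof (rule sum_mono)
      fix r assume r: "r \<in> {i..<i'}"
      with ic S i' have "1 \<le> r" "r < d" "c \<in> C" by auto
      with super[of r "g r" c] g_in g_le[OF ic, of r] p_step[of r] r
      show "w r c - w (Suc r) c \<le> p r - p (Suc r)" by simp
    qed
    with tele[OF True, of "\<lambda>r. w r c"] tele[OF True, of p] show ?thesis by simp
  next
    case False
    hence le: "i' \<le> i" by simp
    have "(\<Sum>r=i'..<i. p r - p (Suc r)) \<le> (\<Sum>r=i'..<i. w r c - w (Suc r) c)"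
    proof (rule sum_mono)
      fix r assume r: "r \<in> {i'..<i}"
      with ic S i' have "1 \<le> r" "r < d" "c \<in> C" by auto
      with super[of r c "g r"] g_in g_ge[OF ic, of r] p_step[of r] r
      show "p r - p (Suc r) \<le> w r c - w (Suc r) c" by simp
    qed
    with tele[OF le, of "\<lambda>r. w r c"] tele[OF le, of p] show ?thesis by simp
  qed
  have q_le: "q c \<le> w i c - p i" if "i \<in> {1..d}" for i c
    unfolding q_def by (rule Min_le) (use that in auto)
  have q_eq: "q c = w i c - p i" if "(i, c) \<in> S" for i c
    unfolding q_def by (rule Min_eqI) (use opt[OF that] S that in auto)
  show ?thesis
  proof (rule exI[of _ p], rule exI[of _ q], intro conjI)
    show "\<forall>i\<in>{1..d}. \<forall>c\<in>C. p i + q c \<le> w i c"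
      using q_le by (simp add: le_diff_eq add.commute)
    show "\<forall>i c. (i, c) \<in> S \<longrightarrow> p i + q c = w i c" using q_eq by simp
    show "\<forall>r. 1 \<le> r \<and> r < d \<longrightarrow> (\<exists>c\<in>C. p r - p (Suc r) = w r c - w (Suc r) c)"
      using p_step g_in by blast
  qed
qed

text \<open>
  The level of \<open>x\<close> is the largest length of a chain that ends in \<open>x\<close>; an element above \<open>x\<close> extends
  such a chain and so has a larger level.
\<close>

lemma antichain_levels:
  fixes R :: "'a \<Rightarrow> 'a \<Rightarrow> bool"
  assumes trans: "\<And>x y z. R x y \<Longrightarrow> R y z \<Longrightarrow> R x z"
    and no_chain: "\<not> (\<exists>f. (\<forall>a\<le>n. f a \<in> P) \<and> (\<forall>a b. a < b \<and> b \<le> n \<longrightarrow> R (f a) (f b)))"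
  obtains h :: "'a \<Rightarrow> nat" where "\<And>x. x \<in> P \<Longrightarrow> h x < n"
    "\<And>x y. x \<in> P \<Longrightarrow> y \<in> P \<Longrightarrow> R x y \<Longrightarrow> h x \<noteq> h y"
proof -
  \<comment> \<open>\<open>E k x\<close>: some chain of \<open>k + 1\<close> elements of \<open>P\<close> ends in \<open>x\<close>.\<close>
  define E :: "nat \<Rightarrow> 'a \<Rightarrow> bool" where "E = (\<lambda>k x. \<exists>f::nat \<Rightarrow> 'a. f k = x \<and> (\<forall>a\<le>k. f a \<in> P) \<and>
    (\<forall>a b. a < b \<and> b \<le> k \<longrightarrow> R (f a) (f b)))"
  define h where "h = (\<lambda>x. Max {k. k < n \<and> E k x})"
  have E0: "E 0 x" if "x \<in> P" for x
    unfolding E_def by (rule exI[of _ "\<lambda>_. x"]) (use that in auto)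
  have E_Suc: "E (Suc k) y" if "E k x" "R x y" "y \<in> P" for k x y
  proof -
    from that(1) obtain f where f: "f k = x" "\<And>a. a \<le> k \<Longrightarrow> f a \<in> P"
      "\<And>a b. a < b \<Longrightarrow> b \<le> k \<Longrightarrow> R (f a) (f b)" unfolding E_def by blast
    have "R (f a) y" if "a \<le> k" for a
      using f that \<open>R x y\<close> trans[of "f a" x y] by (cases "a = k") auto
    with f that(3) show ?thesis
      unfolding E_def by (intro exI[of _ "f(Suc k := y)"]) (auto simp: le_Suc_eq)
  qed
  have En: "\<not> E n x" for x using no_chain unfolding E_def by blast
  have pos: "0 < n" if "x \<in> P" for x
    using En[of x] E0[OF that] by (cases n) auto
  have h_in: "h x < n \<and> E (h x) x" if "x \<in> P" for x
  proof -
    have "h x \<in> {k. k < n \<and> E k x}" unfolding h_def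
      by (rule Max_in) (use E0[OF that] pos[OF that] in auto)
    thus ?thesis by simp
  qed
  have "h x < h y" if "x \<in> P" "y \<in> P" "R x y" for x y
  proof -
    have E: "E (Suc (h x)) y" using E_Suc h_in that by blast
    with En[of y] h_in[OF that(1)] have "Suc (h x) < n"
      by (metis Suc_lessI)
    with E have "Suc (h x) \<in> {k. k < n \<and> E k y}" by simp
    hence "Suc (h x) \<le> Max {k. k < n \<and> E k y}" by (intro Max_ge) auto
    thus ?thesis by (simp add: h_def)
  qed
  with h_in show ?thesis by (intro that[of h]) (auto, fastforce)
qed

text \<open>
  Potentials for a set \<open>S\<close> of positions with short chains only. Here \<open>n\<close> plays the part of \<open>t - 1\<close>:
  it bounds the length of the chains through different blocks and is the number of rank-one
  summands. The term \<open>\<alpha> (j, l)\<close> does not depend on the summand \<open>s\<close>; this makes each block of the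
  resulting matrix a matrix of rank one.
\<close>

lemma tropical_point:
  fixes w :: "nat \<Rightarrow> nat \<times> nat \<Rightarrow> real" and n :: nat
  assumes dims: "1 \<le> d" "1 \<le> k1" "1 \<le> k2"
    and super: "\<And>r j l j' l'. 1 \<le> r \<Longrightarrow> r < d \<Longrightarrow> j \<in> {1..k1} \<Longrightarrow> j' \<in> {1..k1} \<Longrightarrow>
      l \<in> {1..k2} \<Longrightarrow> l' \<in> {1..k2} \<Longrightarrow> l < l' \<or> l = l' \<and> j < j' \<Longrightarrow>
      w r (j', l') - w (Suc r) (j', l') \<le> w r (j, l) - w (Suc r) (j, l)"
    and S: "S \<subseteq> vars d k1 k2"
    and block: "\<And>i j i' j' l. (i, (j, l)) \<in> S \<Longrightarrow> (i', (j', l)) \<in> S \<Longrightarrow> i < i' \<Longrightarrow> j' \<le> j"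
    and no_chain: "\<not> (\<exists>\<rho> \<gamma>. (\<forall>a\<le>n. (\<rho> a, \<gamma> a) \<in> S) \<and>
      (\<forall>a b. a < b \<and> b \<le> n \<longrightarrow> \<rho> a < \<rho> b \<and> snd (\<gamma> a) < snd (\<gamma> b)))"
  shows "\<exists>(p :: nat \<Rightarrow> nat \<Rightarrow> real) (q :: nat \<Rightarrow> nat \<Rightarrow> real) \<alpha>.
    (\<forall>s i j l. s < n \<and> (i, (j, l)) \<in> vars d k1 k2 \<longrightarrow> p s i + q s l + \<alpha> (j, l) \<le> w i (j, l)) \<and>
    (\<forall>i j l. (i, (j, l)) \<in> S \<longrightarrow> (\<exists>s<n. p s i + q s l + \<alpha> (j, l) = w i (j, l)))"
proof -
  have "\<exists>b a. (\<forall>i\<in>{1..d}. \<forall>j\<in>{1..k1}. b i + a j \<le> w i (j, l)) \<and>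
      (\<forall>i j. (i, (j, l)) \<in> S \<longrightarrow> b i + a j = w i (j, l)) \<and>
      (\<forall>r. 1 \<le> r \<and> r < d \<longrightarrow>
        (\<exists>j\<in>{1..k1}. b r - b (Suc r) = w r (j, l) - w (Suc r) (j, l)))"
    if l: "l \<in> {1..k2}" for l
  proof -
    let ?S = "{(i, j). (i, (j, l)) \<in> S}"
    have le: "w r (j', l) - w (Suc r) (j', l) \<le> w r (j, l) - w (Suc r) (j, l)"
      if "1 \<le> r" "r < d" "j \<in> {1..k1}" "j' \<in> {1..k1}" "j \<le> j'" for r j j'
      using super[of r j j' l l] that l by (cases "j = j'") auto
    have S': "?S \<subseteq> {1..d} \<times> {1..k1}" using S by (auto simp: vars_def)
    have anti: "j' \<le> j" if "(i, j) \<in> ?S" "(i', j') \<in> ?S" "i < i'" for i j i' j'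
      using block that by blast
    have "\<exists>b a. (\<forall>i\<in>{1..d}. \<forall>j\<in>{1..k1}. b i + a j \<le> w i (j, l)) \<and>
      (\<forall>i j. (i, j) \<in> ?S \<longrightarrow> b i + a j = w i (j, l)) \<and>
      (\<forall>r. 1 \<le> r \<and> r < d \<longrightarrow>
        (\<exists>j\<in>{1..k1}. b r - b (Suc r) = w r (j, l) - w (Suc r) (j, l)))"
    proof (rule supermodular_potentials)
      show "?S \<subseteq> {1..d} \<times> {1..k1}" by (fact S')
      show "w r (j', l) - w (Suc r) (j', l) \<le> w r (j, l) - w (Suc r) (j, l)"
        if "1 \<le> r" "r < d" "j \<in> {1..k1}" "j' \<in> {1..k1}" "j \<le> j'" for r j j'
        using that by (rule le)
      show "j' \<le> j" if "(i, j) \<in> ?S" "(i', j') \<in> ?S" "i < i'" for i j i' j'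
        using that by (rule anti)
    qed (use dims in simp_all)
    thus ?thesis by simp
  qed
  then obtain b a where
    ba_le: "\<And>l i j. l \<in> {1..k2} \<Longrightarrow> i \<in> {1..d} \<Longrightarrow> j \<in> {1..k1} \<Longrightarrow> b l i + a l j \<le> w i (j, l)" and
    ba_eq: "\<And>l i j. l \<in> {1..k2} \<Longrightarrow> (i, (j, l)) \<in> S \<Longrightarrow> b l i + a l j = w i (j, l)" and
    b_step: "\<And>l r. l \<in> {1..k2} \<Longrightarrow> 1 \<le> r \<Longrightarrow> r < d \<Longrightarrow>
        (\<exists>j\<in>{1..k1}. b l r - b l (Suc r) = w r (j, l) - w (Suc r) (j, l))"
    by metis
  \<comment> \<open>The row differences of \<open>b l\<close> come from columns of block \<open>l\<close>, and blocks are ordered like their columns.\<close>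
  have b_super: "b l' r - b l' (Suc r) \<le> b l r - b l (Suc r)"
    if r: "1 \<le> r" "r < d" and l: "l \<in> {1..k2}" "l' \<in> {1..k2}" "l \<le> l'" for r l l'
  proof (cases "l = l'")
    case False
    obtain j where "j \<in> {1..k1}" "b l r - b l (Suc r) = w r (j, l) - w (Suc r) (j, l)"
      using b_step r l by blast
    moreover obtain j' where "j' \<in> {1..k1}"
      "b l' r - b l' (Suc r) = w r (j', l') - w (Suc r) (j', l')"
      using b_step r l by blast
    ultimately show ?thesis using super[of r j j' l l'] r l False by simp
  qed simp
  \<comment> \<open>The image of \<open>S\<close> in the matrix with one column for each block.\<close>
  define P where "P = {(i, l). \<exists>j. (i, (j, l)) \<in> S}"
  define R :: "nat \<times> nat \<Rightarrow> nat \<times> nat \<Rightarrow> bool"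
    where "R = (\<lambda>x y. fst x < fst y \<and> snd x < snd y)"
  have P_sub: "P \<subseteq> {1..d} \<times> {1..k2}" using S by (auto simp: P_def vars_def)
  have "\<not> (\<exists>f. (\<forall>a\<le>n. f a \<in> P) \<and> (\<forall>a b. a < b \<and> b \<le> n \<longrightarrow> R (f a) (f b)))"
  proof
    assume "\<exists>f. (\<forall>a\<le>n. f a \<in> P) \<and> (\<forall>a b. a < b \<and> b \<le> n \<longrightarrow> R (f a) (f b))"
    then obtain f where "(\<forall>a\<le>n. f a \<in> P) \<and> (\<forall>a b. a < b \<and> b \<le> n \<longrightarrow> R (f a) (f b))" ..
    hence f: "\<And>a. a \<le> n \<Longrightarrow> f a \<in> P" "\<And>a b. a < b \<Longrightarrow> b \<le> n \<Longrightarrow> R (f a) (f b)"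
      by simp_all
    have "\<exists>j. a \<le> n \<longrightarrow> (fst (f a), (j, snd (f a))) \<in> S" for a
      using f(1)[of a] by (cases "f a") (auto simp: P_def)
    then obtain J where "\<And>a. a \<le> n \<Longrightarrow> (fst (f a), (J a, snd (f a))) \<in> S" by metis
    with f(2) have "(\<forall>a\<le>n. (fst (f a), (J a, snd (f a))) \<in> S) \<and>
      (\<forall>a b. a < b \<and> b \<le> n \<longrightarrow> fst (f a) < fst (f b) \<and>
        snd (J a, snd (f a)) < snd (J b, snd (f b)))" by (auto simp: R_def)
    with no_chain show False
      by (elim notE, intro exI[of _ "\<lambda>a. fst (f a)"] exI[of _ "\<lambda>a. (J a, snd (f a))"])
  qed
  then obtain h where h: "\<And>x. x \<in> P \<Longrightarrow> h x < n"
    "\<And>x y. x \<in> P \<Longrightarrow> y \<in> P \<Longrightarrow> R x y \<Longrightarrow> h x \<noteq> h y"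
    using antichain_levels[of R n P] by (auto simp: R_def)
  have "\<exists>p q. (\<forall>i\<in>{1..d}. \<forall>l\<in>{1..k2}. p i + q l \<le> b l i) \<and>
      (\<forall>i l. (i, l) \<in> P \<and> h (i, l) = s \<longrightarrow> p i + q l = b l i)" for s
  proof -
    let ?S = "{x \<in> P. h x = s}"
    have anti: "l' \<le> l" if "(i, l) \<in> ?S" "(i', l') \<in> ?S" "i < i'" for i l i' l'
      using h(2)[of "(i, l)" "(i', l')"] that by (fastforce simp: R_def)
    have S': "?S \<subseteq> {1..d} \<times> {1..k2}" using P_sub by blast
    have "\<exists>p q. (\<forall>i\<in>{1..d}. \<forall>l\<in>{1..k2}. p i + q l \<le> b l i) \<and>
      (\<forall>i l. (i, l) \<in> ?S \<longrightarrow> p i + q l = b l i) \<and>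
      (\<forall>r. 1 \<le> r \<and> r < d \<longrightarrow> (\<exists>l\<in>{1..k2}. p r - p (Suc r) = b l r - b l (Suc r)))"
    proof (rule supermodular_potentials)
      show "?S \<subseteq> {1..d} \<times> {1..k2}" by (fact S')
      show "b l' r - b l' (Suc r) \<le> b l r - b l (Suc r)"
        if "1 \<le> r" "r < d" "l \<in> {1..k2}" "l' \<in> {1..k2}" "l \<le> l'" for r l l'
        using that by (rule b_super)
      show "l' \<le> l" if "(i, l) \<in> ?S" "(i', l') \<in> ?S" "i < i'" for i l i' l'
        using that by (rule anti)
    qed (use dims in simp_all)
    thus ?thesis by (elim exE conjE) (intro exI conjI, assumption, simp)
  qed
  then obtain p q where pq: "\<And>s. (\<forall>i\<in>{1..d}. \<forall>l\<in>{1..k2}. p s i + q s l \<le> b l i) \<and>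
      (\<forall>i l. (i, l) \<in> P \<and> h (i, l) = s \<longrightarrow> p s i + q s l = b l i)"
    by metis
  have pq_le: "\<And>s i l. i \<in> {1..d} \<Longrightarrow> l \<in> {1..k2} \<Longrightarrow> p s i + q s l \<le> b l i"
    and pq_eq: "\<And>s i l. (i, l) \<in> P \<Longrightarrow> h (i, l) = s \<Longrightarrow> p s i + q s l = b l i"
    using pq by blast+
  show ?thesis
  proof (rule exI[of _ p], rule exI[of _ q], rule exI[of _ "\<lambda>(j, l). a l j"], intro conjI allI impI)
    fix s i j l assume "s < n \<and> (i, (j, l)) \<in> vars d k1 k2"
    with pq_le[of i l s] ba_le[of l i j] show "p s i + q s l + (\<lambda>(j, l). a l j) (j, l) \<le> w i (j, l)"
      by (auto simp: vars_def)
  next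
    fix i j l assume ijl: "(i, (j, l)) \<in> S"
    hence P: "(i, l) \<in> P" and l: "l \<in> {1..k2}" using S by (auto simp: P_def vars_def)
    show "\<exists>s<n. p s i + q s l + (\<lambda>(j, l). a l j) (j, l) = w i (j, l)"
      using h(1)[OF P] pq_eq[OF P refl] ba_eq[OF l ijl] by (intro exI[of _ "h (i, l)"]) auto
  qed
qed

section \<open>Evaluation of polynomials\<close>

definition mono_eval :: "('v \<Rightarrow> 'a::comm_semiring_1) \<Rightarrow> 'v monomial \<Rightarrow> 'a" where
  "mono_eval x m = (\<Prod>v\<in>Poly_Mapping.keys m. x v ^ Poly_Mapping.lookup m v)"

definition poly_eval :: "('v \<Rightarrow> complex) \<Rightarrow> 'v cpoly \<Rightarrow> complex" where
  "poly_eval x f = (\<Sum>m\<in>Poly_Mapping.keys f. Poly_Mapping.lookup f m * mono_eval x m)"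

lemma mono_eval_superset:
  assumes "finite A" "Poly_Mapping.keys m \<subseteq> A"
  shows "mono_eval x m = (\<Prod>v\<in>A. x v ^ Poly_Mapping.lookup m v)"
  unfolding mono_eval_def by (rule prod.mono_neutral_left) (use assms in \<open>auto simp: in_keys_iff\<close>)

lemma mono_eval_0 [simp]: "mono_eval x 0 = 1"
  by (simp add: mono_eval_def)

lemma mono_eval_add: "mono_eval x (m + m') = mono_eval x m * mono_eval x m'"
proof -
  let ?A = "Poly_Mapping.keys m \<union> Poly_Mapping.keys m'"
  have "Poly_Mapping.keys (m + m') \<subseteq> ?A" by (rule Poly_Mapping.keys_add)
  thus ?thesis
    by (simp add: mono_eval_superset[of ?A] lookup_add power_add prod.distrib)
qed

lemma poly_eval_superset:
  assumes "finite A" "Poly_Mapping.keys f \<subseteq> A"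
  shows "poly_eval x f = (\<Sum>m\<in>A. Poly_Mapping.lookup f m * mono_eval x m)"
  unfolding poly_eval_def by (rule sum.mono_neutral_left) (use assms in \<open>auto simp: in_keys_iff\<close>)

lemma poly_eval_0 [simp]: "poly_eval x 0 = 0"
  by (simp add: poly_eval_def)

lemma poly_eval_add: "poly_eval x (f + g) = poly_eval x f + poly_eval x g"
proof -
  let ?A = "Poly_Mapping.keys f \<union> Poly_Mapping.keys g"
  have "Poly_Mapping.keys (f + g) \<subseteq> ?A" by (rule Poly_Mapping.keys_add)
  thus ?thesis
    by (simp add: poly_eval_superset[of ?A] lookup_add distrib_right sum.distrib)
qed

lemma poly_eval_single [simp]: "poly_eval x (Poly_Mapping.single m c) = c * mono_eval x m"
  by (simp add: poly_eval_def)

text \<open>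
  Polynomials are sums of terms, so identities that are additive need checking on terms only.
\<close>

lemma poly_mapping_add_induct [case_names zero single add]:
  fixes f :: "'a \<Rightarrow>\<^sub>0 'b::comm_monoid_add"
  assumes "P 0" "\<And>m c. P (Poly_Mapping.single m c)" "\<And>f g. P f \<Longrightarrow> P g \<Longrightarrow> P (f + g)"
  shows "P f"
proof (induction f rule: update_induct)
  case (update f m c)
  have "Poly_Mapping.update m c f = f + Poly_Mapping.single m c"
    by (rule poly_mapping_eqI)
      (use update.hyps(1) in \<open>auto simp: lookup_update lookup_add lookup_single in_keys_iff when_def\<close>)
  with update.IH assms show ?case by metis
qed fact

lemma poly_eval_mult: "poly_eval x (f * g) = poly_eval x f * poly_eval x g"
proof -
  have *: "poly_eval x (f * Poly_Mapping.single m c) = poly_eval x f * (c * mono_eval x m)" for m c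
    by (induction f rule: poly_mapping_add_induct)
      (auto simp: mult_single mono_eval_add poly_eval_add distrib_right)
  show ?thesis
    by (induction g rule: poly_mapping_add_induct)
      (auto simp: * poly_eval_add distrib_left)
qed

lemma poly_eval_hom: "comm_ring_hom (poly_eval x)"
proof
  show "poly_eval x 1 = 1"
    by (simp flip: single_one)
qed (simp_all add: poly_eval_add poly_eval_mult)

lemma poly_eval_Var [simp]: "poly_eval x (Var v) = x v"
  by (simp add: Var_def mono_eval_def)

text \<open>
  Pad the two factors of size \<open>n \<times> r\<close> and \<open>r \<times> n\<close> to square matrices; the first one then has a zero
  column.
\<close>

lemma det_low_rank:
  fixes A :: "'a::comm_ring_1 mat"
  assumes "A \<in> carrier_mat n n" and "r < n"
    and "\<And>i j. i < n \<Longrightarrow> j < n \<Longrightarrow> A $$ (i, j) = (\<Sum>s<r. u s i * v s j)"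
  shows "det A = 0"
proof -
  define U where "U = mat n n (\<lambda>(i, s). if s < r then u s i else 0)"
  define V where "V = mat n n (\<lambda>(s, j). v s j)"
  have "A = U * V"
  proof (rule eq_matI)
    fix i j assume "i < dim_row (U * V)" "j < dim_col (U * V)"
    hence ij: "i < n" "j < n" by (auto simp: U_def V_def)
    have "(U * V) $$ (i, j) = (\<Sum>s=0..<n. (if s < r then u s i else 0) * v s j)"
      using ij by (auto simp: U_def V_def scalar_prod_def intro!: sum.cong)
    also have "\<dots> = (\<Sum>s<r. u s i * v s j)"
      using \<open>r < n\<close> by (intro sum.mono_neutral_cong_right) auto
    finally show "A $$ (i, j) = (U * V) $$ (i, j)" using assms ij by simp
  qed (use assms in \<open>auto simp: U_def V_def\<close>)
  moreover have "det U = 0"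
  proof -
    have "(\<Prod>j=0..<n. U $$ (p j, j)) = 0" if "p permutes {0..<n}" for p
    proof (rule prod_zero)
      have "p r < n" using permutes_in_image[OF that, of r] \<open>r < n\<close> by simp
      with \<open>r < n\<close> show "\<exists>j\<in>{0..<n}. U $$ (p j, j) = 0"
        by (intro bexI[of _ r]) (auto simp: U_def)
    qed simp
    moreover have "U \<in> carrier_mat n n" by (simp add: U_def)
    ultimately show ?thesis
      by (simp add: det_col[of U n] atLeast0LessThan del: prod_zero_iff)
  qed
  moreover have "U \<in> carrier_mat n n" "V \<in> carrier_mat n n" by (auto simp: U_def V_def)
  ultimately show ?thesis by (simp add: det_mult)
qed

section \<open>Weights for the lexicographic order\<close>

text \<open>
  In base \<open>N\<close> the left-hand side has the digits \<open>N - 1\<close> and 0, and at most \<open>k\<close> of them.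
\<close>

lemma powers_below:
  fixes N :: nat and e :: "'v \<Rightarrow> nat"
  assumes "1 \<le> N" "finite U" "inj_on e U" "\<And>u. u \<in> U \<Longrightarrow> e u < k"
  shows "(\<Sum>u\<in>U. N ^ e u * (N - 1)) < N ^ k"
proof -
  have "(\<Sum>u\<in>U. N ^ e u * (N - 1)) = (\<Sum>i\<in>e ` U. N ^ i * (N - 1))"
    using assms by (simp add: sum.reindex)
  also have "\<dots> \<le> (\<Sum>i<k. N ^ i * (N - 1))"
    by (rule sum_mono2) (use assms in auto)
  also have "\<dots> < N ^ k"
  proof (induction k)
    case (Suc k)
    have "N ^ k * (N - 1) + N ^ k = N ^ Suc k"
      using assms(1) by (cases N) (auto simp: algebra_simps)
    with Suc show ?case by simp
  qed simp
  finally show ?thesis .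
qed

text \<open>
  On finitely many monomials the lexicographic order is given by integer weights: read the
  exponents as the digits of a number in a base \<open>N\<close> that exceeds all of them, with the digits
  ordered as the variables. The first conclusion, that each weight is at least twice every smaller
  one, is what makes the weights supermodular as a function of row and column.
\<close>

lemma lex_weights:
  fixes gt :: "'v \<Rightarrow> 'v \<Rightarrow> bool"
  assumes irrefl: "\<And>u. \<not> gt u u" and trans: "\<And>u v w. gt u v \<Longrightarrow> gt v w \<Longrightarrow> gt u w"
    and total: "\<And>u v. u \<noteq> v \<Longrightarrow> gt u v \<or> gt v u"
    and V: "finite V" and M: "finite M" "\<And>m. m \<in> M \<Longrightarrow> Poly_Mapping.keys m \<subseteq> V"
  shows "\<exists>w :: 'v \<Rightarrow> nat. (\<forall>u\<in>V. \<forall>v\<in>V. gt v u \<longrightarrow> 2 * w u \<le> w v) \<and>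
    (\<forall>m\<in>M. \<forall>m'\<in>M. lex_less gt m' m \<longrightarrow>
      (\<Sum>v\<in>V. w v * Poly_Mapping.lookup m' v) < (\<Sum>v\<in>V. w v * Poly_Mapping.lookup m v))"
proof -
  define e where "e = (\<lambda>v. card {u \<in> V. gt v u})"
  define N where "N = Max (insert 1 ((\<lambda>(m, v). Poly_Mapping.lookup m v) ` (M \<times> V))) + 1"
  have N_ge: "2 \<le> N"
    using Max_ge[of "insert 1 ((\<lambda>(m, v). Poly_Mapping.lookup m v) ` (M \<times> V))" 1] V M
    by (auto simp: N_def)
  have N_gt: "Poly_Mapping.lookup m v \<le> N - 1" if "m \<in> M" "v \<in> V" for m v
    unfolding N_def diff_add_inverse2
    by (rule Max_ge) (use that V M in \<open>auto intro!: image_eqI[of _ _ "(m, v)"]\<close>)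
  have e_less: "e u < e v" if "u \<in> V" "v \<in> V" "gt v u" for u v
  proof -
    have "{x \<in> V. gt u x} \<subseteq> {x \<in> V. gt v x}" using that(3) trans by blast
    moreover have "u \<in> {x \<in> V. gt v x} - {x \<in> V. gt u x}" using that irrefl by simp
    ultimately have "{x \<in> V. gt u x} \<subset> {x \<in> V. gt v x}" by blast
    thus ?thesis unfolding e_def using V by (intro psubset_card_mono) auto
  qed
  have e_inj: "inj_on e V"
    by (rule inj_onI, rule ccontr) (use total e_less in fastforce)
  show ?thesis
  proof (rule exI[of _ "\<lambda>v. N ^ e v"], intro conjI ballI impI)
    fix u v assume "u \<in> V" "v \<in> V" "gt v u"
    hence "Suc (e u) \<le> e v" using e_less by fastforce
    hence "N ^ Suc (e u) \<le> N ^ e v" using N_ge by (intro power_increasing) auto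
    moreover have "2 * N ^ e u \<le> N ^ Suc (e u)" using N_ge by simp
    ultimately show "2 * N ^ e u \<le> N ^ e v" by linarith
  next
    fix m m' assume mM: "m \<in> M" "m' \<in> M" and "lex_less gt m' m"
    then obtain v where v: "Poly_Mapping.lookup m' v < Poly_Mapping.lookup m v"
      and above: "\<And>u. gt u v \<Longrightarrow> Poly_Mapping.lookup m' u = Poly_Mapping.lookup m u"
      unfolding lex_less_def by blast
    have vV: "v \<in> V" using v M(2)[OF mM(1)] by (auto simp: in_keys_iff)
    let ?G = "{u \<in> V. gt u v}" and ?L = "{u \<in> V. gt v u}"
    have split: "(\<Sum>u\<in>V. f u) = (\<Sum>u\<in>?G. f u) + f v + (\<Sum>u\<in>?L. f u)" for f :: "'v \<Rightarrow> nat"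
    proof -
      have "V = ?G \<union> ({v} \<union> ?L)" using vV total by blast
      hence "(\<Sum>u\<in>V. f u) = (\<Sum>u\<in>?G \<union> ({v} \<union> ?L). f u)" by simp
      also have "\<dots> = (\<Sum>u\<in>?G. f u) + (\<Sum>u\<in>{v} \<union> ?L. f u)"
        using V irrefl trans by (intro sum.union_disjoint) (simp, simp, blast)
      also have "(\<Sum>u\<in>{v} \<union> ?L. f u) = f v + (\<Sum>u\<in>?L. f u)" using V irrefl by simp
      finally show ?thesis by simp
    qed
    have "(\<Sum>u\<in>?L. N ^ e u * Poly_Mapping.lookup m' u) \<le> (\<Sum>u\<in>?L. N ^ e u * (N - 1))"
      using N_gt[OF mM(2)] by (intro sum_mono mult_left_mono) auto
    also have "\<dots> < N ^ e v"
      using N_ge V e_less vV inj_on_subset[OF e_inj] by (intro powers_below) auto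
    finally have "N ^ e v * Poly_Mapping.lookup m' v + (\<Sum>u\<in>?L. N ^ e u * Poly_Mapping.lookup m' u)
      < N ^ e v * Suc (Poly_Mapping.lookup m' v)" by simp
    also have "\<dots> \<le> N ^ e v * Poly_Mapping.lookup m v"
      using v by (intro mult_left_mono) auto
    finally show "(\<Sum>u\<in>V. N ^ e u * Poly_Mapping.lookup m' u) < (\<Sum>u\<in>V. N ^ e u * Poly_Mapping.lookup m u)"
      unfolding split using above by simp
  qed
qed

lemma var_gt_irrefl: "\<not> var_gt u u"
  by (cases u rule: prod_cases3) auto

lemma var_gt_trans: "var_gt u v \<Longrightarrow> var_gt v w \<Longrightarrow> var_gt u w"
  by (cases u rule: prod_cases3; cases v rule: prod_cases3; cases w rule: prod_cases3) auto

lemma var_gt_total: "u \<noteq> v \<Longrightarrow> var_gt u v \<or> var_gt v u"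
  by (cases u rule: prod_cases3; cases v rule: prod_cases3) auto

lemma finite_has_biggest_var:
  assumes "finite D" "D \<noteq> {}"
  shows "\<exists>v\<in>D. \<forall>u\<in>D. \<not> var_gt u v"
  using assms
proof (induction rule: finite_ne_induct)
  case (singleton x)
  thus ?case using var_gt_irrefl by simp
next
  case (insert x F)
  then obtain v where v: "v \<in> F" "\<And>u. u \<in> F \<Longrightarrow> \<not> var_gt u v" by blast
  show ?case
  proof (cases "var_gt x v")
    case True
    with v have "\<not> var_gt u x" if "u \<in> insert x F" for u
      using that var_gt_irrefl var_gt_trans by blast
    thus ?thesis by blast
  qed (use v in blast)
qed

lemma lex_less_total:
  assumes "m \<noteq> m'"
  shows "lex_less var_gt m m' \<or> lex_less var_gt m' m"
proof -
  let ?D = "{v. Poly_Mapping.lookup m v \<noteq> Poly_Mapping.lookup m' v}"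
  have "?D \<subseteq> Poly_Mapping.keys m \<union> Poly_Mapping.keys m'" by (auto simp: in_keys_iff)
  hence fin: "finite ?D" by (rule finite_subset) simp
  moreover have "?D \<noteq> {}"
  proof
    assume "?D = {}"
    hence "m = m'" by (intro poly_mapping_eqI) auto
    with assms show False by simp
  qed
  ultimately have "\<exists>v\<in>?D. \<forall>u\<in>?D. \<not> var_gt u v" by (rule finite_has_biggest_var)
  then obtain v where vD: "v \<in> ?D" and max: "\<forall>u\<in>?D. \<not> var_gt u v" by (rule bexE)
  from vD have v: "Poly_Mapping.lookup m v \<noteq> Poly_Mapping.lookup m' v" by simp
  from max have above: "\<forall>u. var_gt u v \<longrightarrow> Poly_Mapping.lookup m u = Poly_Mapping.lookup m' u"
    by (simp del: var_gt.simps) blast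
  from v consider "Poly_Mapping.lookup m v < Poly_Mapping.lookup m' v"
    | "Poly_Mapping.lookup m' v < Poly_Mapping.lookup m v" by linarith
  thus ?thesis
  proof cases
    case 1
    with above show ?thesis unfolding lex_less_def by blast
  next
    case 2
    moreover from above have "\<forall>u. var_gt u v \<longrightarrow> Poly_Mapping.lookup m' u = Poly_Mapping.lookup m u"
      by simp
    ultimately show ?thesis unfolding lex_less_def by blast
  qed
qed

text \<open>
  Along a numerical grading the antisymmetry of the order on the terms of \<open>f\<close> is immediate, and its
  greatest monomial is found as a maximum of natural numbers.
\<close>

lemma lex_grading:
  "\<exists>W :: var monomial \<Rightarrow> nat. \<forall>m\<in>Poly_Mapping.keys f. \<forall>m'\<in>Poly_Mapping.keys f.
     lex_less var_gt m' m \<longrightarrow> W m' < W m"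
proof -
  let ?V = "\<Union>m\<in>Poly_Mapping.keys f. Poly_Mapping.keys m"
  have "\<exists>w :: var \<Rightarrow> nat. (\<forall>u\<in>?V. \<forall>v\<in>?V. var_gt v u \<longrightarrow> 2 * w u \<le> w v) \<and>
    (\<forall>m\<in>Poly_Mapping.keys f. \<forall>m'\<in>Poly_Mapping.keys f. lex_less var_gt m' m \<longrightarrow>
      (\<Sum>v\<in>?V. w v * Poly_Mapping.lookup m' v) < (\<Sum>v\<in>?V. w v * Poly_Mapping.lookup m v))"
    by (rule lex_weights) (rule var_gt_irrefl var_gt_total | erule (1) var_gt_trans | auto)+
  then obtain w where
    "(\<forall>u\<in>?V. \<forall>v\<in>?V. var_gt v u \<longrightarrow> 2 * w u \<le> w v) \<and>
     (\<forall>m\<in>Poly_Mapping.keys f. \<forall>m'\<in>Poly_Mapping.keys f. lex_less var_gt m' m \<longrightarrow>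
      (\<Sum>v\<in>?V. w v * Poly_Mapping.lookup m' v) < (\<Sum>v\<in>?V. w v * Poly_Mapping.lookup m v))" ..
  hence "\<forall>m\<in>Poly_Mapping.keys f. \<forall>m'\<in>Poly_Mapping.keys f. lex_less var_gt m' m \<longrightarrow>
      (\<Sum>v\<in>?V. w v * Poly_Mapping.lookup m' v) < (\<Sum>v\<in>?V. w v * Poly_Mapping.lookup m v)" ..
  thus ?thesis by (rule exI[of _ "\<lambda>m. \<Sum>v\<in>?V. w v * Poly_Mapping.lookup m v"])
qed

lemma leading_monomial_eqI:
  assumes "m \<in> Poly_Mapping.keys f"
    and "\<And>m'. m' \<in> Poly_Mapping.keys f \<Longrightarrow> m' \<noteq> m \<Longrightarrow> lex_less var_gt m' m"
  shows "leading_monomial (lex_less var_gt) f = m"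
  unfolding leading_monomial_def
proof (rule the_equality)
  fix m' assume m': "m' \<in> Poly_Mapping.keys f \<and>
    (\<forall>m''\<in>Poly_Mapping.keys f. m'' \<noteq> m' \<longrightarrow> lex_less var_gt m'' m')"
  obtain W :: "var monomial \<Rightarrow> nat" where W: "\<And>m m'. m \<in> Poly_Mapping.keys f \<Longrightarrow> m' \<in> Poly_Mapping.keys f \<Longrightarrow>
      lex_less var_gt m' m \<Longrightarrow> W m' < W m"
    using lex_grading[of f] by blast
  show "m' = m"
  proof (rule ccontr)
    assume "m' \<noteq> m"
    with m' assms have "lex_less var_gt m m'" "lex_less var_gt m' m" by auto
    from W[OF _ _ this(1)] W[OF _ _ this(2)] m' assms(1) show False by simp
  qed
qed (use assms in blast)

lemma leading_monomial_max:
  assumes "f \<noteq> 0"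
  shows "leading_monomial (lex_less var_gt) f \<in> Poly_Mapping.keys f \<and>
    (\<forall>m'\<in>Poly_Mapping.keys f. m' \<noteq> leading_monomial (lex_less var_gt) f \<longrightarrow>
      lex_less var_gt m' (leading_monomial (lex_less var_gt) f))"
proof -
  obtain W :: "var monomial \<Rightarrow> nat" where W: "\<And>m m'. m \<in> Poly_Mapping.keys f \<Longrightarrow>
      m' \<in> Poly_Mapping.keys f \<Longrightarrow> lex_less var_gt m' m \<Longrightarrow> W m' < W m"
    using lex_grading[of f] by blast
  have "Poly_Mapping.keys f \<noteq> {}" using assms by simp
  hence "Max (W ` Poly_Mapping.keys f) \<in> W ` Poly_Mapping.keys f" by (intro Max_in) auto
  then obtain m where m: "m \<in> Poly_Mapping.keys f" "W m = Max (W ` Poly_Mapping.keys f)" by auto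
  hence "W m' \<le> W m" if "m' \<in> Poly_Mapping.keys f" for m' using that by simp
  hence max: "lex_less var_gt m' m" if "m' \<in> Poly_Mapping.keys f" "m' \<noteq> m" for m'
    using that m W lex_less_total by (metis leD)
  thus ?thesis using m(1) leading_monomial_eqI[OF m(1) max] by simp
qed

section \<open>Dominant terms\<close>

lemma mono_eval_of_real: "mono_eval (\<lambda>v. complex_of_real (x v)) m = of_real (mono_eval x m)"
  by (simp add: mono_eval_def)

text \<open>
  The other terms have weight at most \<open>W m - 1\<close>, so together they are bounded by \<open>B * exp (\<tau> * (W m
  - 1))\<close> with \<open>B\<close> independent of \<open>\<tau>\<close>, whereas the term of \<open>m\<close> is at least \<open>c m * exp (\<tau> * W m)\<close>.
  Hence every \<open>\<tau> \<ge> 0\<close> with \<open>c m * exp \<tau> > B\<close> will do.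
\<close>

lemma dominant_term_nonvanishing:
  fixes w :: "'v \<Rightarrow> nat" and x :: "real \<Rightarrow> 'v \<Rightarrow> real" and V :: "'v set"
  defines "W \<equiv> \<lambda>m. \<Sum>v\<in>V. w v * Poly_Mapping.lookup m v"
  assumes V: "finite V" "\<And>m. m \<in> Poly_Mapping.keys f \<Longrightarrow> Poly_Mapping.keys m \<subseteq> V"
    and m: "m \<in> Poly_Mapping.keys f"
    and dom: "\<And>m'. m' \<in> Poly_Mapping.keys f \<Longrightarrow> m' \<noteq> m \<Longrightarrow> W m' < W m"
    and nonneg: "\<And>(\<tau>::real) v. 0 \<le> x \<tau> v"
    and upper: "\<And>(\<tau>::real) v. 0 \<le> \<tau> \<Longrightarrow> v \<in> V \<Longrightarrow> x \<tau> v \<le> K * exp (\<tau> * real (w v))"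
    and lower: "\<And>(\<tau>::real) v. 0 \<le> \<tau> \<Longrightarrow> v \<in> Poly_Mapping.keys m \<Longrightarrow> exp (\<tau> * real (w v)) \<le> x \<tau> v"
  obtains \<tau> where "poly_eval (\<lambda>v. complex_of_real (x \<tau> v)) f \<noteq> 0"
proof -
  define c where "c = (\<lambda>m. norm (Poly_Mapping.lookup f m))"
  define B where "B = (\<Sum>m'\<in>Poly_Mapping.keys f - {m}. c m' * (\<Prod>v\<in>V. \<bar>K\<bar> ^ Poly_Mapping.lookup m' v))"
  have c_pos: "0 < c m" using m by (simp add: c_def in_keys_iff)
  have B_nonneg: "0 \<le> B" unfolding B_def c_def by (intro sum_nonneg mult_nonneg_nonneg prod_nonneg) auto
  \<comment> \<open>This choice suffices since \<open>exp \<tau> \<ge> 1 + \<tau>\<close>.\<close>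
  define \<tau> where "\<tau> = B / c m"
  have \<tau>: "0 \<le> \<tau>" using B_nonneg c_pos by (simp add: \<tau>_def)
  have expW: "(\<Prod>v\<in>V. exp (\<tau> * w v) ^ Poly_Mapping.lookup m' v) = exp (\<tau> * W m')" for m' :: "'v monomial"
    unfolding W_def using V(1)
    by (simp add: exp_sum sum_distrib_left exp_of_nat_mult[symmetric] mult_ac)
  have up: "mono_eval (x \<tau>) m' \<le> (\<Prod>v\<in>V. \<bar>K\<bar> ^ Poly_Mapping.lookup m' v) * exp (\<tau> * (real (W m) - 1))"
    if "m' \<in> Poly_Mapping.keys f - {m}" for m'
  proof -
    have "x \<tau> v \<le> \<bar>K\<bar> * exp (\<tau> * w v)" if "v \<in> V" for v
      using upper[OF \<tau> that] by (rule order_trans) (intro mult_right_mono, auto)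
    hence "mono_eval (x \<tau>) m' \<le> (\<Prod>v\<in>V. (\<bar>K\<bar> * exp (\<tau> * w v)) ^ Poly_Mapping.lookup m' v)"
      using that V nonneg
      by (subst mono_eval_superset[of V]) (auto intro!: prod_mono power_mono)
    also have "\<dots> = (\<Prod>v\<in>V. \<bar>K\<bar> ^ Poly_Mapping.lookup m' v) * exp (\<tau> * W m')"
      by (simp add: power_mult_distrib prod.distrib expW)
    also have "\<dots> \<le> (\<Prod>v\<in>V. \<bar>K\<bar> ^ Poly_Mapping.lookup m' v) * exp (\<tau> * (real (W m) - 1))"
    proof (intro mult_left_mono)
      have "real (W m') \<le> real (W m) - 1" using dom[of m'] that by auto
      thus "exp (\<tau> * W m') \<le> exp (\<tau> * (real (W m) - 1))" using \<tau> by (simp add: mult_left_mono)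
    qed (auto intro: prod_nonneg)
    finally show ?thesis .
  qed
  have low: "exp (\<tau> * W m) \<le> mono_eval (x \<tau>) m"
  proof -
    have "exp (\<tau> * W m) = (\<Prod>v\<in>Poly_Mapping.keys m. exp (\<tau> * w v) ^ Poly_Mapping.lookup m v)"
      unfolding expW[symmetric]
      by (rule prod.mono_neutral_right) (use V m in \<open>auto simp: in_keys_iff\<close>)
    also have "\<dots> \<le> mono_eval (x \<tau>) m"
      unfolding mono_eval_def using lower[OF \<tau>] by (auto intro!: prod_mono power_mono)
    finally show ?thesis .
  qed
  have mono_nonneg: "0 \<le> mono_eval (x \<tau>) m'" for m' :: "'v monomial"
    using nonneg by (simp add: mono_eval_def prod_nonneg)
  have "poly_eval (\<lambda>v. complex_of_real (x \<tau> v)) f \<noteq> 0"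
  proof
    assume "poly_eval (\<lambda>v. complex_of_real (x \<tau> v)) f = 0"
    hence "Poly_Mapping.lookup f m * of_real (mono_eval (x \<tau>) m) =
      - (\<Sum>m'\<in>Poly_Mapping.keys f - {m}. Poly_Mapping.lookup f m' * of_real (mono_eval (x \<tau>) m'))"
      using m by (simp add: poly_eval_def mono_eval_of_real sum.remove[of _ m] add_eq_0_iff2)
    hence "norm (Poly_Mapping.lookup f m * of_real (mono_eval (x \<tau>) m)) =
      norm (\<Sum>m'\<in>Poly_Mapping.keys f - {m}. Poly_Mapping.lookup f m' * of_real (mono_eval (x \<tau>) m'))"
      by simp
    also have "\<dots> \<le> (\<Sum>m'\<in>Poly_Mapping.keys f - {m}. c m' * mono_eval (x \<tau>) m')"
      using mono_nonneg by (intro sum_norm_le) (simp add: norm_mult c_def)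
    also have "\<dots> \<le> (\<Sum>m'\<in>Poly_Mapping.keys f - {m}.
        c m' * ((\<Prod>v\<in>V. \<bar>K\<bar> ^ Poly_Mapping.lookup m' v) * exp (\<tau> * (real (W m) - 1))))"
      using up by (intro sum_mono mult_left_mono) (auto simp: c_def)
    also have "\<dots> = B * exp (\<tau> * (real (W m) - 1))"
      by (simp add: B_def sum_distrib_right mult.assoc)
    finally have "c m * mono_eval (x \<tau>) m \<le> B * exp (\<tau> * (real (W m) - 1))"
      using mono_nonneg by (simp add: norm_mult c_def)
    moreover have "c m * exp (\<tau> * W m) \<le> c m * mono_eval (x \<tau>) m"
      using low c_pos by simp
    moreover have "exp (\<tau> * W m) = exp \<tau> * exp (\<tau> * (real (W m) - 1))"
      by (simp add: exp_add[symmetric] algebra_simps)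
    hence "c m * exp \<tau> * exp (\<tau> * (real (W m) - 1)) = c m * exp (\<tau> * W m)" by simp
    ultimately have "c m * exp \<tau> * exp (\<tau> * (real (W m) - 1)) \<le> B * exp (\<tau> * (real (W m) - 1))"
      by linarith
    hence "c m * exp \<tau> \<le> B" by simp
    moreover have "c m * (1 + \<tau>) \<le> c m * exp \<tau>" using c_pos exp_ge_add_one_self by simp
    moreover have "c m * (1 + \<tau>) = c m + B" using c_pos by (simp add: \<tau>_def algebra_simps)
    ultimately show False using c_pos by linarith
  qed
  thus ?thesis by (rule that)
qed

section \<open>Leading monomials of minors\<close>

definition col_less :: "nat \<times> nat \<Rightarrow> nat \<times> nat \<Rightarrow> bool" where
  "col_less c c' \<longleftrightarrow> snd c < snd c' \<or> snd c = snd c' \<and> fst c < fst c'"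

lemma var_gt_iff: "var_gt u v \<longleftrightarrow> col_less (snd u) (snd v) \<or> snd u = snd v \<and> fst u < fst v"
  by (cases u rule: prod_cases3; cases v rule: prod_cases3) (auto simp: col_less_def)

definition perm_monomial :: "(nat \<Rightarrow> nat) \<Rightarrow> (nat \<Rightarrow> nat \<times> nat) \<Rightarrow> nat \<Rightarrow> (nat \<Rightarrow> nat) \<Rightarrow> var monomial" where
  "perm_monomial \<rho> \<gamma> n p = (\<Sum>a<n. Poly_Mapping.single (\<rho> a, \<gamma> (p a)) 1)"

lemma lookup_perm_monomial:
  "Poly_Mapping.lookup (perm_monomial \<rho> \<gamma> n p) v = (\<Sum>a<n. if (\<rho> a, \<gamma> (p a)) = v then 1 else 0)"
  unfolding perm_monomial_def lookup_sum by (rule sum.cong) (auto simp: lookup_single when_def)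

lemma prod_Var:
  "(\<Prod>a<(n::nat). Var (f a)) = Poly_Mapping.single (\<Sum>a<n. Poly_Mapping.single (f a) 1) 1"
  by (induction n) (simp_all add: Var_def mult_single add.commute)

lemma det_Var:
  "det (mat n n (\<lambda>(a, b). Var (\<rho> a, \<gamma> b))) =
    (\<Sum>p\<in>{p. p permutes {0..<n}}. Poly_Mapping.single (perm_monomial \<rho> \<gamma> n p) (signof p))"
proof -
  have "signof p * (\<Prod>a=0..<n. mat n n (\<lambda>(a, b). Var (\<rho> a, \<gamma> b)) $$ (a, p a)) =
      Poly_Mapping.single (perm_monomial \<rho> \<gamma> n p) (signof p)" if p: "p permutes {0..<n}" for p
  proof -
    have "(\<Prod>a=0..<n. mat n n (\<lambda>(a, b). Var (\<rho> a, \<gamma> b)) $$ (a, p a)) = (\<Prod>a<n. Var (\<rho> a, \<gamma> (p a)))"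
    proof (rule prod.cong)
      fix a assume "a \<in> {..<n}"
      hence "a < n" "p a < n" using permutes_in_image[OF p, of a] by simp_all
      thus "mat n n (\<lambda>(a, b). Var (\<rho> a, \<gamma> b)) $$ (a, p a) = Var (\<rho> a, \<gamma> (p a))" by simp
    qed auto
    moreover have "signof p * Poly_Mapping.single m 1 = Poly_Mapping.single m (signof p :: complex)" for m :: "var monomial"
      by (simp add: sign_def single_uminus)
    ultimately show ?thesis by (simp only: prod_Var perm_monomial_def)
  qed
  thus ?thesis by (simp add: det_def)
qed

text \<open>
  Let \<open>k\<close> be the first index that \<open>p\<close> moves. Both monomials have the same variables in the rows
  before the \<open>k\<close>-th; from there on \<open>p\<close> takes values at least \<open>k\<close>, and the value \<open>k\<close> only in a later
  row. So the variable at position \<open>(\<rho> k, \<gamma> k)\<close> is the biggest one where they differ, and it occurs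
  in the diagonal monomial only.
\<close>

lemma perm_monomial_less:
  assumes \<rho>: "\<And>a b. a < b \<Longrightarrow> b < n \<Longrightarrow> \<rho> a < \<rho> b"
    and \<gamma>: "\<And>a b. a < b \<Longrightarrow> b < n \<Longrightarrow> col_less (\<gamma> a) (\<gamma> b)"
    and p: "p permutes {0..<n}" "p \<noteq> id"
  shows "lex_less var_gt (perm_monomial \<rho> \<gamma> n p) (perm_monomial \<rho> \<gamma> n id)"
proof -
  define k where "k = (LEAST k. p k \<noteq> k)"
  have pk: "p k \<noteq> k" unfolding k_def by (rule LeastI_ex) (use p(2) in auto)
  have fixed: "p a = a" if "a < k" for a using not_less_Least[of a] that unfolding k_def by blast
  have kn: "k < n" using pk p(1) permutes_not_in by fastforce
  have inj: "p a = p b \<longleftrightarrow> a = b" for a b using permutes_inj[OF p(1)] by (auto dest: injD)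
  have pn: "p a < n" if "a < n" for a using permutes_in_image[OF p(1), of a] that by simp
  have p_ge: "k \<le> p a" if "k \<le> a" for a
    using fixed[of "p a"] inj[of "p a" a] that by (cases "p a < k") auto
  have \<rho>_inj: "\<rho> a = \<rho> b \<longleftrightarrow> a = b" if "a < n" "b < n" for a b
    using \<rho>[of a b] \<rho>[of b a] that by (cases a b rule: linorder_cases) auto
  have \<gamma>_inj: "\<gamma> a = \<gamma> b \<longleftrightarrow> a = b" if "a < n" "b < n" for a b
    using \<gamma>[of a b] \<gamma>[of b a] that by (cases a b rule: linorder_cases) (auto simp: col_less_def)
  let ?v = "(\<rho> k, \<gamma> k)"
  have "Poly_Mapping.lookup (perm_monomial \<rho> \<gamma> n p) ?v = 0"
    unfolding lookup_perm_monomial using kn pn pk \<rho>_inj \<gamma>_inj by (intro sum.neutral) auto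
  moreover have "0 < Poly_Mapping.lookup (perm_monomial \<rho> \<gamma> n id) ?v"
    unfolding lookup_perm_monomial using kn by (intro sum_pos2[of _ k]) auto
  moreover have "Poly_Mapping.lookup (perm_monomial \<rho> \<gamma> n p) u = Poly_Mapping.lookup (perm_monomial \<rho> \<gamma> n id) u"
    if u: "var_gt u ?v" for u
    unfolding lookup_perm_monomial
  proof (rule sum.cong[OF refl])
    fix a assume "a \<in> {..<n}"
    hence a: "a < n" by simp
    show "(if (\<rho> a, \<gamma> (p a)) = u then 1 else 0) = (if (\<rho> a, \<gamma> (id a)) = u then 1 else (0::nat))"
    proof (cases "a < k")
      case False
      hence ka: "k \<le> a" by simp
      have "\<not> var_gt (\<rho> a, \<gamma> a) ?v"
        using ka a \<rho>[of k a] \<gamma>[of k a] by (cases "k = a") (auto simp: var_gt_iff col_less_def)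
      moreover have "\<not> var_gt (\<rho> a, \<gamma> (p a)) ?v"
      proof (cases "p a = k")
        case True
        hence "a \<noteq> k" using pk by auto
        thus ?thesis using True ka a \<rho>[of k a] by (auto simp: var_gt_iff col_less_def)
      next
        case False
        hence "k < p a" using p_ge[OF ka] by simp
        thus ?thesis using \<gamma>[of k "p a"] pn[OF a] by (auto simp: var_gt_iff col_less_def)
      qed
      ultimately show ?thesis using u by auto
    qed (simp add: fixed)
  qed
  ultimately show ?thesis unfolding lex_less_def by (intro exI[of _ ?v]) simp
qed

text \<open>
  The coefficient of the diagonal monomial is 1, because by \<open>perm_monomial_less\<close> no other
  permutation contributes to it.
\<close>

lemma leading_monomial_minor:
  assumes \<rho>: "\<And>a b. a < b \<Longrightarrow> b < n \<Longrightarrow> \<rho> a < \<rho> b"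
    and \<gamma>: "\<And>a b. a < b \<Longrightarrow> b < n \<Longrightarrow> col_less (\<gamma> a) (\<gamma> b)"
  defines "D \<equiv> det (mat n n (\<lambda>(a, b). Var (\<rho> a, \<gamma> b)))"
  shows "D \<noteq> 0" and "leading_monomial (lex_less var_gt) D = (\<Sum>a<n. Poly_Mapping.single (\<rho> a, \<gamma> a) 1)"
proof -
  let ?m = "perm_monomial \<rho> \<gamma> n id"
  have neq: "perm_monomial \<rho> \<gamma> n p \<noteq> ?m" if "p permutes {0..<n}" "p \<noteq> id" for p
    using perm_monomial_less[OF \<rho> \<gamma> that] unfolding lex_less_def by fastforce
  have "Poly_Mapping.lookup D ?m = (\<Sum>p\<in>{p. p permutes {0..<n}}. if p = id then 1 else 0)"
    unfolding D_def det_Var lookup_sum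
    by (rule sum.cong) (use neq in \<open>auto simp: lookup_single when_def\<close>)
  also have "\<dots> = 1" by (simp add: permutes_id finite_permutations)
  finally have m: "?m \<in> Poly_Mapping.keys D" by (simp add: in_keys_iff)
  thus "D \<noteq> 0" by auto
  have "lex_less var_gt m' ?m" if m': "m' \<in> Poly_Mapping.keys D" "m' \<noteq> ?m" for m'
  proof -
    have "Poly_Mapping.lookup D m' \<noteq> 0" using m'(1) by (simp add: in_keys_iff)
    then obtain p where p: "p permutes {0..<n}" "m' = perm_monomial \<rho> \<gamma> n p"
      unfolding D_def det_Var lookup_sum lookup_single
      by (elim sum.not_neutral_contains_not_neutral) (auto simp: when_def split: if_splits)
    with m'(2) have "p \<noteq> id" by auto
    with p perm_monomial_less[OF \<rho> \<gamma>] show ?thesis by simp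
  qed
  from leading_monomial_eqI[OF m this]
  show "leading_monomial (lex_less var_gt) D = (\<Sum>a<n. Poly_Mapping.single (\<rho> a, \<gamma> a) 1)"
    by (simp add: perm_monomial_def)
qed

lemma strict_mono_inj_on_lessThan:
  fixes f :: "nat \<Rightarrow> nat"
  assumes "\<And>a b. a < b \<Longrightarrow> b < n \<Longrightarrow> f a < f b"
  shows "inj_on f {..<n}"
proof (rule inj_onI)
  fix a b assume "a \<in> {..<n}" "b \<in> {..<n}" "f a = f b"
  thus "a = b" using assms[of a b] assms[of b a] by (cases a b rule: linorder_cases) auto
qed

lemma pick_strict_mono_image:
  fixes f :: "nat \<Rightarrow> nat"
  assumes mono: "\<And>a b. a < b \<Longrightarrow> b < n \<Longrightarrow> f a < f b" and a: "a < n"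
  shows "pick (f ` {..<n}) a = f a"
proof -
  have less: "f b < f a \<longleftrightarrow> b < a" if "b < n" for b
    using mono[of a b] mono[of b a] a that by (cases a b rule: linorder_cases) auto
  have "{x \<in> f ` {..<n}. x < f a} = f ` {b \<in> {..<n}. f b < f a}" by auto
  also have "{b \<in> {..<n}. f b < f a} = {..<a}" using less a by fastforce
  finally have "{x \<in> f ` {..<n}. x < f a} = f ` {..<a}" .
  moreover have "inj_on f {..<a}"
    by (rule inj_on_subset[OF strict_mono_inj_on_lessThan[OF mono, of n]]) (use a in auto)
  ultimately have "card {x \<in> f ` {..<n}. x < f a} = a" by (simp add: card_image)
  with pick_card_in_set[of "f a" "f ` {..<n}"] a show ?thesis by simp
qed

text \<open>
  Index sets of a minor are replaced by their increasing enumerations; chains of positions come as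
  such sequences.
\<close>

lemma minors_mat:
  "minors n (mat D C f) = {det (mat n n (\<lambda>(a, b). f (\<rho> a, \<gamma> b))) | \<rho> \<gamma>.
     (\<forall>a b. a < b \<and> b < n \<longrightarrow> \<rho> a < \<rho> b \<and> \<gamma> a < \<gamma> b) \<and> (\<forall>a<n. \<rho> a < D \<and> \<gamma> a < C)}"
  (is "?L = ?R")
proof -
  have sub: "submatrix (mat D C f) A B = mat n n (\<lambda>(a, b). f (pick A a, pick B b))"
    if "A \<subseteq> {..<D}" "card A = n" "B \<subseteq> {..<C}" "card B = n" for A B
  proof -
    have "{i. i < D \<and> i \<in> A} = A" "{i. i < C \<and> i \<in> B} = B" using that by auto
    moreover have "pick A a \<in> A" "pick B a \<in> B" if "a < n" for a
      using pick_in_set_le[of a] that \<open>card A = n\<close> \<open>card B = n\<close> by auto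
    ultimately show ?thesis using that
      unfolding submatrix_def by (intro eq_matI) (auto simp: subset_iff)
  qed
  show ?thesis
  proof (intro equalityI subsetI)
    fix x assume "x \<in> ?L"
    then obtain A B where AB: "A \<subseteq> {..<D}" "card A = n" "B \<subseteq> {..<C}" "card B = n"
      and x: "x = det (submatrix (mat D C f) A B)" by (auto simp: minors_def)
    have "(\<forall>a b. a < b \<and> b < n \<longrightarrow> pick A a < pick A b \<and> pick B a < pick B b) \<and>
        (\<forall>a<n. pick A a < D \<and> pick B a < C)"
    proof (intro conjI allI impI)
      fix a b assume "a < b \<and> b < n"
      thus "pick A a < pick A b" "pick B a < pick B b"
        using AB pick_mono_le[of b A a] pick_mono_le[of b B a] by simp_all
    next
      fix a assume "a < n"
      thus "pick A a < D" "pick B a < C"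
        using AB pick_in_set_le[of a A] pick_in_set_le[of a B] by auto
    qed
    thus "x \<in> ?R" unfolding x sub[OF AB]
      by (intro CollectI exI[of _ "pick A"] exI[of _ "pick B"] conjI refl) simp_all
  next
    fix x assume "x \<in> ?R"
    then obtain \<rho> \<gamma> where x: "x = det (mat n n (\<lambda>(a, b). f (\<rho> a, \<gamma> b)))"
      and *: "\<forall>a b. a < b \<and> b < n \<longrightarrow> \<rho> a < \<rho> b \<and> \<gamma> a < \<gamma> b" "\<forall>a<n. \<rho> a < D \<and> \<gamma> a < C"
      by (elim CollectE exE conjE) (rule that)
    from * have mono: "\<And>a b. a < b \<Longrightarrow> b < n \<Longrightarrow> \<rho> a < \<rho> b" "\<And>a b. a < b \<Longrightarrow> b < n \<Longrightarrow> \<gamma> a < \<gamma> b"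
      and bound: "\<And>a. a < n \<Longrightarrow> \<rho> a < D" "\<And>a. a < n \<Longrightarrow> \<gamma> a < C" by simp_all
    have card: "card (\<rho> ` {..<n}) = n" "card (\<gamma> ` {..<n}) = n"
      using strict_mono_inj_on_lessThan[of n \<rho>] strict_mono_inj_on_lessThan[of n \<gamma>] mono
      by (simp_all add: card_image)
    have subset: "\<rho> ` {..<n} \<subseteq> {..<D}" "\<gamma> ` {..<n} \<subseteq> {..<C}" using bound by auto
    have pick: "pick (\<rho> ` {..<n}) a = \<rho> a" "pick (\<gamma> ` {..<n}) a = \<gamma> a" if "a < n" for a
      using pick_strict_mono_image[of n \<rho> a] pick_strict_mono_image[of n \<gamma> a] mono that by blast+
    have "submatrix (mat D C f) (\<rho> ` {..<n}) (\<gamma> ` {..<n}) = mat n n (\<lambda>(a, b). f (\<rho> a, \<gamma> b))"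
      unfolding sub[OF subset(1) card(1) subset(2) card(2)] by (rule eq_matI) (simp_all add: pick)
    with x subset card show "x \<in> ?L" unfolding minors_def
      by (intro CollectI exI[of _ "\<rho> ` {..<n}"] exI[of _ "\<gamma> ` {..<n}"]) simp
  qed
qed

lemma finite_minors: "finite (minors n Y)"
proof -
  have "minors n Y \<subseteq> (\<lambda>(A, B). det (submatrix Y A B)) ` (Pow {..<dim_row Y} \<times> Pow {..<dim_col Y})"
    unfolding minors_def by force
  thus ?thesis by (rule finite_subset) simp
qed

section \<open>Ideals of the polynomial ring\<close>

lemma poly_ring_simps:
  "carrier (poly_ring V) = {f. \<forall>m\<in>Poly_Mapping.keys f. Poly_Mapping.keys m \<subseteq> V}"
  "f \<otimes>\<^bsub>poly_ring V\<^esub> g = f * g" "f \<oplus>\<^bsub>poly_ring V\<^esub> g = f + g"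
  "\<one>\<^bsub>poly_ring V\<^esub> = 1" "\<zero>\<^bsub>poly_ring V\<^esub> = 0"
  by (simp_all add: poly_ring_def)

lemma poly_ring_closed:
  assumes "f \<in> carrier (poly_ring V)" "g \<in> carrier (poly_ring V)"
  shows "f + g \<in> carrier (poly_ring V)" "f * g \<in> carrier (poly_ring V)"
proof -
  show "f + g \<in> carrier (poly_ring V)"
    using assms Poly_Mapping.keys_add[of f g] by (auto simp: poly_ring_simps)
  show "f * g \<in> carrier (poly_ring V)"
    unfolding poly_ring_simps
  proof (intro CollectI ballI)
    fix m assume "m \<in> Poly_Mapping.keys (f * g)"
    then obtain a b where m: "m = a + b" and ab: "a \<in> Poly_Mapping.keys f" "b \<in> Poly_Mapping.keys g"
      using keys_mult[of f g] by blast
    have "Poly_Mapping.keys m \<subseteq> Poly_Mapping.keys a \<union> Poly_Mapping.keys b"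
      unfolding m by (rule Poly_Mapping.keys_add)
    moreover have "Poly_Mapping.keys a \<subseteq> V" "Poly_Mapping.keys b \<subseteq> V"
      using ab assms by (simp_all add: poly_ring_simps)
    ultimately show "Poly_Mapping.keys m \<subseteq> V" by blast
  qed
qed

lemma poly_ring_uminus_closed: "f \<in> carrier (poly_ring V) \<Longrightarrow> - f \<in> carrier (poly_ring V)"
  by (simp add: poly_ring_simps)

lemma ring_poly_ring: "ring (poly_ring V)"
proof (rule ringI)
  show "abelian_group (poly_ring V)"
  proof (rule abelian_groupI)
    fix f assume "f \<in> carrier (poly_ring V)"
    thus "\<exists>g\<in>carrier (poly_ring V). g \<oplus>\<^bsub>poly_ring V\<^esub> f = \<zero>\<^bsub>poly_ring V\<^esub>"
      by (intro bexI[of _ "- f"]) (simp_all add: poly_ring_uminus_closed poly_ring_simps(2-))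
  next
    show "\<zero>\<^bsub>poly_ring V\<^esub> \<in> carrier (poly_ring V)" by (simp add: poly_ring_simps)
  qed (simp_all add: poly_ring_closed poly_ring_simps(2-) add_ac)
  show "monoid (poly_ring V)"
  proof (rule monoidI)
    show "\<one>\<^bsub>poly_ring V\<^esub> \<in> carrier (poly_ring V)" by (simp add: poly_ring_simps)
  qed (simp_all add: poly_ring_closed poly_ring_simps(2-) mult_ac)
qed (simp_all add: poly_ring_simps(2-) algebra_simps)

text \<open>
  Ideals of \<^const>\<open>poly_ring\<close> generated by polynomials that vanish at a point vanish there as a
  whole, by minimality against this ideal.
\<close>

lemma vanishing_ideal:
  "ideal {f \<in> carrier (poly_ring V). poly_eval x f = 0} (poly_ring V)" (is "ideal ?K ?R")
proof (rule idealI)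
  interpret ring ?R by (rule ring_poly_ring)
  have uminus: "\<ominus>\<^bsub>?R\<^esub> f = - f" if "f \<in> carrier ?R" for f
    by (rule minus_equality) (use that in \<open>simp_all add: poly_ring_uminus_closed poly_ring_simps(2-)\<close>)
  have eval_uminus: "poly_eval x (- f) = - poly_eval x f" for f
    using poly_eval_add[of x f "- f"] by (simp add: add_eq_0_iff)
  show "subgroup ?K (add_monoid ?R)"
  proof (rule add.subgroupI)
    show "?K \<noteq> {}" by (auto intro!: exI[of _ 0] simp: poly_ring_simps)
    show "\<ominus>\<^bsub>?R\<^esub> f \<in> ?K" if "f \<in> ?K" for f
      using that by (simp add: uminus eval_uminus poly_ring_uminus_closed)
  qed (auto simp: poly_ring_closed poly_ring_simps(2-) poly_eval_add)
qed (auto simp: ring_poly_ring poly_ring_closed poly_ring_simps(2-) poly_eval_mult)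

lemma Idl_vanish:
  assumes "G \<subseteq> carrier (poly_ring V)" "\<And>g. g \<in> G \<Longrightarrow> poly_eval x g = 0"
    and "f \<in> Idl\<^bsub>poly_ring V\<^esub> G"
  shows "poly_eval x f = 0"
proof -
  have "Idl\<^bsub>poly_ring V\<^esub> G \<subseteq> {f \<in> carrier (poly_ring V). poly_eval x f = 0}"
    by (rule ring.genideal_minimal[OF ring_poly_ring vanishing_ideal]) (use assms in auto)
  with assms(3) show ?thesis by auto
qed

section \<open>Minors of the generic matrix and of its blocks\<close>

lemma generic_minor_in_poly_ring:
  fixes \<rho> :: "nat \<Rightarrow> nat" and \<gamma> :: "nat \<Rightarrow> nat \<times> nat"
  assumes "\<And>a b. a < n \<Longrightarrow> b < n \<Longrightarrow> (\<rho> a, \<gamma> b) \<in> V"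
  shows "det (mat n n (\<lambda>(a, b). Var (\<rho> a, \<gamma> b))) \<in> carrier (poly_ring V)"
  unfolding poly_ring_simps
proof (intro CollectI ballI)
  fix m assume "m \<in> Poly_Mapping.keys (det (mat n n (\<lambda>(a, b). Var (\<rho> a, \<gamma> b))))"
  hence "Poly_Mapping.lookup (det (mat n n (\<lambda>(a, b). Var (\<rho> a, \<gamma> b)))) m \<noteq> 0"
    by (simp add: in_keys_iff)
  then obtain p where p: "p permutes {0..<n}" "m = perm_monomial \<rho> \<gamma> n p"
    unfolding det_Var lookup_sum lookup_single
    by (elim sum.not_neutral_contains_not_neutral) (auto simp: when_def split: if_splits)
  have "p a < n" if "a < n" for a using permutes_in_image[OF p(1), of a] that by simp
  hence "(\<Union>a\<in>{..<n}. Poly_Mapping.keys (Poly_Mapping.single (\<rho> a, \<gamma> (p a)) (1::nat))) \<subseteq> V"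
    using assms by auto
  thus "Poly_Mapping.keys m \<subseteq> V"
    unfolding p(2) perm_monomial_def using keys_sum by (rule order_trans[rotated])
qed

lemma poly_eval_minor:
  "poly_eval x (det (mat n n (\<lambda>(a, b). Var (\<rho> a, \<gamma> b)))) = det (mat n n (\<lambda>(a, b). x (\<rho> a, \<gamma> b)))"
proof -
  interpret comm_ring_hom "poly_eval x" by (rule poly_eval_hom)
  have "map_mat (poly_eval x) (mat n n (\<lambda>(a, b). Var (\<rho> a, \<gamma> b))) = mat n n (\<lambda>(a, b). x (\<rho> a, \<gamma> b))"
    by (rule eq_matI) auto
  thus ?thesis by (metis hom_det)
qed

lemma block_matrix_eq:
  assumes "1 \<le> k1" "l \<in> {1..k2}"
  shows "block_matrix d k1 k2 l = mat d k1 (\<lambda>(i, c). Var (i + 1, (c + 1, l)))"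
proof -
  define f where "f = (\<lambda>c. (l - 1) * k1 + c)"
  let ?J = "{c. c < k1 * k2 \<and> column_label k1 c \<in> block k1 l}"
  have label: "column_label k1 (f c) = (c + 1, l)" if "c < k1" for c
    using that assms by (simp add: column_label_def f_def)
  have bound: "f c < k1 * k2" if "c < k1" for c
  proof -
    have "f c < (l - 1) * k1 + k1" using that by (simp add: f_def)
    also have "\<dots> = k1 * l" using assms by (cases l) (auto simp: algebra_simps)
    also have "\<dots> \<le> k1 * k2" using assms by simp
    finally show ?thesis .
  qed
  have J: "?J = f ` {..<k1}"
  proof (intro equalityI subsetI)
    fix c assume "c \<in> ?J"
    hence "c div k1 = l - 1" by (auto simp: column_label_def block_def)
    hence "c = f (c mod k1)" unfolding f_def by (metis div_mult_mod_eq)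
    moreover have "c mod k1 < k1" using assms by simp
    ultimately show "c \<in> f ` {..<k1}" by blast
  next
    fix c assume "c \<in> f ` {..<k1}"
    thus "c \<in> ?J" using label bound by (auto simp: block_def)
  qed
  have mono: "\<And>a b. a < b \<Longrightarrow> b < k1 \<Longrightarrow> f a < f b" by (simp add: f_def)
  have pick_J: "pick (f ` {..<k1}) c = f c" if "c < k1" for c
    using mono that by (rule pick_strict_mono_image)
  have pick_d: "pick {..<d} i = i" if "i < d" for i
    using pick_strict_mono_image[of d "\<lambda>i. i" i] that by simp
  have card_J: "card {c. c < k1 * k2 \<and> c \<in> f ` {..<k1}} = k1"
  proof -
    have "{c. c < k1 * k2 \<and> c \<in> f ` {..<k1}} = f ` {..<k1}" using bound by auto
    thus ?thesis using strict_mono_inj_on_lessThan[of k1 f] mono by (simp add: card_image)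
  qed
  have card_d: "card {i. i < d \<and> i \<in> {..<d}} = d" by simp
  show ?thesis
    unfolding block_matrix_def J submatrix_def
    by (rule eq_matI) (simp_all add: generic_matrix_def card_J card_d[simplified] pick_J pick_d bound label)
qed

text \<open>
  Counted from 0, the number of the column labelled \<open>(j, l)\<close> is \<open>(l - 1) * k1 + (j - 1)\<close>, and this
  enumeration is increasing with respect to \<^const>\<open>col_less\<close>.
\<close>

lemma generic_minors_eq:
  assumes "1 \<le> k1"
  shows "minors n (generic_matrix d k1 k2) = {det (mat n n (\<lambda>(a, b). Var (\<rho> a, \<gamma> b))) | \<rho> \<gamma>.
     (\<forall>a b. a < b \<and> b < n \<longrightarrow> \<rho> a < \<rho> b \<and> col_less (\<gamma> a) (\<gamma> b)) \<and>
     (\<forall>a<n. \<forall>b<n. (\<rho> a, \<gamma> b) \<in> vars d k1 k2)}"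
  (is "?L = ?R")
proof (intro equalityI subsetI)
  fix g assume "g \<in> ?L"
  then obtain \<rho> \<gamma> where g: "g = det (mat n n (\<lambda>(a, b). Var (\<rho> a + 1, column_label k1 (\<gamma> b))))"
    and mono: "\<forall>a b. a < b \<and> b < n \<longrightarrow> \<rho> a < \<rho> b \<and> \<gamma> a < \<gamma> b"
    and bound: "\<forall>a<n. \<rho> a < d \<and> \<gamma> a < k1 * k2"
    unfolding generic_matrix_def minors_mat by (elim CollectE exE conjE) (rule that; simp)
  have "col_less (column_label k1 c) (column_label k1 c')" if "c < c'" for c c'
  proof -
    have "c div k1 \<le> c' div k1" using that by (simp add: div_le_mono)
    moreover have "c mod k1 < c' mod k1" if "c div k1 = c' div k1"
      using \<open>c < c'\<close> that by (metis add_less_cancel_left mult_div_mod_eq)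
    ultimately show ?thesis by (auto simp: col_less_def column_label_def)
  qed
  moreover have "(\<rho> a + 1, column_label k1 (\<gamma> b)) \<in> vars d k1 k2" if "a < n" "b < n" for a b
  proof -
    have "\<gamma> b div k1 < k2" using bound that(2) by (simp add: less_mult_imp_div_less mult.commute)
    moreover have "\<gamma> b mod k1 < k1" using assms by simp
    ultimately show ?thesis using bound that by (simp add: vars_def column_label_def Suc_le_eq)
  qed
  ultimately show "g \<in> ?R" using mono
    unfolding g by (intro CollectI exI[of _ "\<lambda>a. \<rho> a + 1"] exI[of _ "\<lambda>b. column_label k1 (\<gamma> b)"]) simp
next
  fix g assume "g \<in> ?R"
  then obtain \<rho> \<gamma> where g: "g = det (mat n n (\<lambda>(a, b). Var (\<rho> a, \<gamma> b)))"
    and mono: "\<forall>a b. a < b \<and> b < n \<longrightarrow> \<rho> a < \<rho> b \<and> col_less (\<gamma> a) (\<gamma> b)"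
    and bound: "\<forall>a<n. \<forall>b<n. (\<rho> a, \<gamma> b) \<in> vars d k1 k2"
    by (elim CollectE exE conjE) (rule that)
  define c where "c = (\<lambda>b. (snd (\<gamma> b) - 1) * k1 + (fst (\<gamma> b) - 1))"
  have \<gamma>: "1 \<le> fst (\<gamma> b) \<and> fst (\<gamma> b) \<le> k1 \<and> 1 \<le> snd (\<gamma> b) \<and> snd (\<gamma> b) \<le> k2" if "b < n" for b
  proof -
    have "(\<rho> b, \<gamma> b) \<in> vars d k1 k2" using bound that by blast
    thus ?thesis by (cases "\<gamma> b") (simp add: vars_def)
  qed
  have \<rho>: "1 \<le> \<rho> a \<and> \<rho> a \<le> d" if "a < n" for a
    using bound that by (auto simp: vars_def)
  have label: "column_label k1 (c b) = \<gamma> b" if "b < n" for b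
  proof -
    have "c b mod k1 = fst (\<gamma> b) - 1" "c b div k1 = snd (\<gamma> b) - 1"
    proof -
      have "fst (\<gamma> b) - 1 < k1" using \<gamma>[OF that] by linarith
      thus "c b mod k1 = fst (\<gamma> b) - 1" "c b div k1 = snd (\<gamma> b) - 1"
        unfolding c_def by (simp_all only: mod_mult_self3 mod_less div_mult_self3 div_less add_0_right)
    qed
    thus ?thesis using \<gamma>[OF that] by (cases "\<gamma> b") (simp add: column_label_def)
  qed
  have row_end: "(l - 1) * k1 + k1 \<le> (l' - 1) * k1" if "1 \<le> l" "l < l'" for l l'
  proof -
    have "Suc (l - 1) * k1 \<le> (l' - 1) * k1" using that by (intro mult_le_mono1) simp
    thus ?thesis by (simp add: add.commute)
  qed
  have c_mono: "c a < c b" if "a < b" "b < n" for a b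
  proof -
    have "col_less (\<gamma> a) (\<gamma> b)" using mono that by simp
    thus ?thesis unfolding col_less_def
    proof
      assume less: "snd (\<gamma> a) < snd (\<gamma> b)"
      have "c a < (snd (\<gamma> a) - 1) * k1 + k1" using \<gamma>[of a] that assms by (auto simp: c_def)
      also have "\<dots> \<le> (snd (\<gamma> b) - 1) * k1" using row_end[OF _ less] \<gamma>[of a] that by simp
      finally show ?thesis by (simp add: c_def)
    next
      assume "snd (\<gamma> a) = snd (\<gamma> b) \<and> fst (\<gamma> a) < fst (\<gamma> b)"
      hence "snd (\<gamma> a) = snd (\<gamma> b)" "fst (\<gamma> a) - 1 < fst (\<gamma> b) - 1" using \<gamma>[of a] that by linarith+
      thus ?thesis by (simp add: c_def)
    qed
  qed
  have c_bound: "c b < k1 * k2" if "b < n" for b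
  proof -
    have "c b < (snd (\<gamma> b) - 1) * k1 + k1" using \<gamma>[OF that] assms by (auto simp: c_def)
    also have "\<dots> = k1 * snd (\<gamma> b)" using \<gamma>[OF that] by (cases "snd (\<gamma> b)") (auto simp: algebra_simps)
    also have "\<dots> \<le> k1 * k2" using \<gamma>[OF that] by simp
    finally show ?thesis .
  qed
  have "\<rho> a - 1 + 1 = \<rho> a" if "a < n" for a using \<rho>[OF that] by simp
  hence "g = det (mat n n (\<lambda>(a, b). Var (\<rho> a - 1 + 1, column_label k1 (c b))))"
    unfolding g by (intro arg_cong[of _ _ det] eq_matI) (simp_all add: label)
  moreover have "\<rho> a - 1 < \<rho> b - 1" if "a < b" "b < n" for a b
  proof -
    have "\<rho> a < \<rho> b" using mono that by blast
    moreover have "1 \<le> \<rho> a" using \<rho>[of a] that by simp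
    ultimately show ?thesis by linarith
  qed
  moreover have "\<rho> a - 1 < d" if "a < n" for a using \<rho>[OF that] by linarith
  ultimately show "g \<in> ?L" unfolding generic_matrix_def minors_mat using c_mono c_bound
    by (intro CollectI exI[of _ "\<lambda>a. \<rho> a - 1"] exI[of _ c]) simp
qed

lemma block_minors_eq:
  assumes "1 \<le> k1" "l \<in> {1..k2}"
  shows "minors n (block_matrix d k1 k2 l) = {det (mat n n (\<lambda>(a, b). Var (\<rho> a, (\<gamma> b, l)))) | \<rho> \<gamma>.
     (\<forall>a b. a < b \<and> b < n \<longrightarrow> \<rho> a < \<rho> b \<and> \<gamma> a < \<gamma> b) \<and>
     (\<forall>a<n. \<rho> a \<in> {1..d} \<and> \<gamma> a \<in> {1..k1})}"
  (is "?L = ?R")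
proof (intro equalityI subsetI)
  fix g assume "g \<in> ?L"
  then obtain \<rho> \<gamma> where g: "g = det (mat n n (\<lambda>(a, b). Var (\<rho> a + 1, (\<gamma> b + 1, l))))"
    and "\<forall>a b. a < b \<and> b < n \<longrightarrow> \<rho> a < \<rho> b \<and> \<gamma> a < \<gamma> b" "\<forall>a<n. \<rho> a < d \<and> \<gamma> a < k1"
    unfolding block_matrix_eq[OF assms] minors_mat by (elim CollectE exE conjE) (rule that; simp)
  thus "g \<in> ?R"
    unfolding g by - (rule CollectI, rule exI[of _ "\<lambda>a. \<rho> a + 1"], rule exI[of _ "\<lambda>b. \<gamma> b + 1"], simp add: Suc_le_eq)
next
  fix g assume "g \<in> ?R"
  then obtain \<rho> \<gamma> where g: "g = det (mat n n (\<lambda>(a, b). Var (\<rho> a, (\<gamma> b, l))))"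
    and mono: "\<forall>a b. a < b \<and> b < n \<longrightarrow> \<rho> a < \<rho> b \<and> \<gamma> a < \<gamma> b"
    and bound: "\<forall>a<n. \<rho> a \<in> {1..d} \<and> \<gamma> a \<in> {1..k1}"
    by (elim CollectE exE conjE) (rule that)
  have "\<rho> a - 1 + 1 = \<rho> a" "\<gamma> a - 1 + 1 = \<gamma> a" if "a < n" for a
  proof -
    have "1 \<le> \<rho> a" "1 \<le> \<gamma> a" using bound that by simp_all
    thus "\<rho> a - 1 + 1 = \<rho> a" "\<gamma> a - 1 + 1 = \<gamma> a" by linarith+
  qed
  hence "g = det (mat n n (\<lambda>(a, b). Var (\<rho> a - 1 + 1, (\<gamma> b - 1 + 1, l))))"
    unfolding g by (intro arg_cong[of _ _ det] eq_matI) simp_all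
  moreover have "\<rho> a - 1 < \<rho> b - 1 \<and> \<gamma> a - 1 < \<gamma> b - 1" if "a < b" "b < n" for a b
  proof -
    have "\<rho> a < \<rho> b \<and> \<gamma> a < \<gamma> b" using mono that by blast
    moreover have "1 \<le> \<rho> a \<and> 1 \<le> \<gamma> a" using bound that by simp
    ultimately show ?thesis by linarith
  qed
  moreover have "\<rho> a - 1 < d \<and> \<gamma> a - 1 < k1" if "a < n" for a
    using bound that by (simp add: Suc_le_eq less_imp_diff_less) (metis One_nat_def Suc_le_eq diff_Suc_less less_le_trans)
  ultimately show "g \<in> ?L" unfolding block_matrix_eq[OF assms] minors_mat
    by - (rule CollectI, rule exI[of _ "\<lambda>a. \<rho> a - 1"], rule exI[of _ "\<lambda>b. \<gamma> b - 1"], simp)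
qed

lemma minors_in_poly_ring:
  assumes "1 \<le> k1"
  shows "minors n (generic_matrix d k1 k2) \<subseteq> carrier (poly_ring (vars d k1 k2))"
    and "l \<in> {1..k2} \<Longrightarrow> minors n (block_matrix d k1 k2 l) \<subseteq> carrier (poly_ring (vars d k1 k2))"
proof -
  show "minors n (generic_matrix d k1 k2) \<subseteq> carrier (poly_ring (vars d k1 k2))"
    unfolding generic_minors_eq[OF assms]
    by (intro subsetI, elim CollectE exE conjE, simp, rule generic_minor_in_poly_ring) simp
  assume l: "l \<in> {1..k2}"
  show "minors n (block_matrix d k1 k2 l) \<subseteq> carrier (poly_ring (vars d k1 k2))"
    unfolding block_minors_eq[OF assms l]
    by (intro subsetI, elim CollectE exE conjE, simp, rule generic_minor_in_poly_ring)
      (use l in \<open>simp add: vars_def\<close>)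
qed

section \<open>The determinantal ideal and its zeros\<close>

lemma zero_in_Idl:
  assumes "G \<subseteq> carrier (poly_ring V)"
  shows "0 \<in> Idl\<^bsub>poly_ring V\<^esub> G"
  using additive_subgroup.zero_closed[OF ideal.axioms(1)[OF ring.genideal_ideal[OF ring_poly_ring assms]]]
  by (simp add: poly_ring_simps)

lemma Idl_subset_carrier:
  assumes "G \<subseteq> carrier (poly_ring V)"
  shows "Idl\<^bsub>poly_ring V\<^esub> G \<subseteq> carrier (poly_ring V)"
  by (rule additive_subgroup.a_subset[OF ideal.axioms(1)[OF ring.genideal_ideal[OF ring_poly_ring assms]]])

lemma I_empty_alt:
  "I_empty d k1 k2 t = {f + (\<Sum>l\<in>{1..k2}. g l) | f g.
     f \<in> minor_ideal (vars d k1 k2) t (generic_matrix d k1 k2) \<and>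
     (\<forall>l\<in>{1..k2}. g l \<in> minor_ideal (vars d k1 k2) 2 (block_matrix d k1 k2 l))}"
  unfolding I_empty_def set_sum_alt[OF finite_atLeastAtMost] set_plus_def by blast

lemma F_empty_subset_I_empty:
  assumes "1 \<le> k1"
  shows "F_empty d k1 k2 t \<subseteq> I_empty d k1 k2 t"
proof
  fix h assume "h \<in> F_empty d k1 k2 t"
  note self = ring.genideal_self[OF ring_poly_ring]
  note carr = minors_in_poly_ring[OF assms]
  consider "h \<in> minors t (generic_matrix d k1 k2)"
    | l where "l \<in> {1..k2}" "h \<in> minors 2 (block_matrix d k1 k2 l)"
    using \<open>h \<in> F_empty d k1 k2 t\<close> unfolding F_empty_def by blast
  thus "h \<in> I_empty d k1 k2 t"
  proof cases
    case 1
    have "h \<in> minor_ideal (vars d k1 k2) t (generic_matrix d k1 k2)"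
      using self[OF carr(1)] 1 unfolding minor_ideal_def by blast
    moreover have "\<forall>l\<in>{1..k2}. 0 \<in> minor_ideal (vars d k1 k2) 2 (block_matrix d k1 k2 l)"
      unfolding minor_ideal_def using zero_in_Idl carr(2) by blast
    ultimately show ?thesis unfolding I_empty_alt
      by (intro CollectI exI[of _ h] exI[of _ "\<lambda>_. 0"]) simp
  next
    case (2 l)
    have "h \<in> minor_ideal (vars d k1 k2) 2 (block_matrix d k1 k2 l)"
      using self[OF carr(2)] 2 unfolding minor_ideal_def by blast
    moreover have "0 \<in> minor_ideal (vars d k1 k2) 2 (block_matrix d k1 k2 l)" if "l \<in> {1..k2}" for l
      unfolding minor_ideal_def using zero_in_Idl carr(2)[OF that] by blast
    moreover have "0 \<in> minor_ideal (vars d k1 k2) t (generic_matrix d k1 k2)"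
      unfolding minor_ideal_def using zero_in_Idl carr(1) by blast
    moreover have "(\<Sum>i\<in>{1..k2}. if i = l then h else 0) = h" using 2(1) by simp
    ultimately show ?thesis unfolding I_empty_alt
      by (intro CollectI exI[of _ 0] exI[of _ "\<lambda>i. if i = l then h else 0"]) simp
  qed
qed

lemma I_empty_subset_carrier:
  assumes "1 \<le> k1"
  shows "I_empty d k1 k2 t \<subseteq> carrier (poly_ring (vars d k1 k2))"
proof
  fix h assume "h \<in> I_empty d k1 k2 t"
  then obtain f g where h: "h = f + (\<Sum>l\<in>{1..k2}. g l)"
    and f: "f \<in> minor_ideal (vars d k1 k2) t (generic_matrix d k1 k2)"
    and g: "\<forall>l\<in>{1..k2}. g l \<in> minor_ideal (vars d k1 k2) 2 (block_matrix d k1 k2 l)"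
    unfolding I_empty_alt by (elim CollectE exE conjE) (rule that)
  note carr = minors_in_poly_ring[OF assms]
  have "(\<Sum>l\<in>A. g l) \<in> carrier (poly_ring (vars d k1 k2))" if "finite A" "A \<subseteq> {1..k2}" for A
    using that
  proof (induction A rule: finite_induct)
    case empty
    show ?case by (simp add: poly_ring_simps)
  next
    case (insert l A)
    hence "g l \<in> carrier (poly_ring (vars d k1 k2))"
      using g Idl_subset_carrier[OF carr(2)[of l]] unfolding minor_ideal_def by blast
    with insert show ?case by (simp add: poly_ring_closed)
  qed
  moreover have "f \<in> carrier (poly_ring (vars d k1 k2))"
    using f Idl_subset_carrier[OF carr(1)] unfolding minor_ideal_def by blast
  ultimately show "h \<in> carrier (poly_ring (vars d k1 k2))"
    unfolding h by (intro poly_ring_closed) auto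
qed

lemma keys_I_empty:
  assumes "1 \<le> k1" "h \<in> I_empty d k1 k2 t" "m \<in> Poly_Mapping.keys h"
  shows "Poly_Mapping.keys m \<subseteq> vars d k1 k2"
proof -
  have "h \<in> carrier (poly_ring (vars d k1 k2))" using I_empty_subset_carrier assms by blast
  with assms(3) show ?thesis by (simp add: poly_ring_simps)
qed

text \<open>
  At such a point the matrix is a sum of \<open>t - 1\<close> matrices of rank one, and in block \<open>l\<close> the factor
  \<open>\<Sum>s<t-1. u s i * v s l\<close> is the same for all columns, so that the block has rank at most one.
\<close>

lemma I_empty_vanish:
  fixes u :: "nat \<Rightarrow> nat \<Rightarrow> complex"
  assumes "1 \<le> k1" "1 \<le> t"
    and x: "\<And>i j l. x (i, (j, l)) = (\<Sum>s<t - 1. u s i * v s l) * y (j, l)"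
    and h: "h \<in> I_empty d k1 k2 t"
  shows "poly_eval x h = 0"
proof -
  obtain f g where hfg: "h = f + (\<Sum>l\<in>{1..k2}. g l)"
    and f: "f \<in> minor_ideal (vars d k1 k2) t (generic_matrix d k1 k2)"
    and g: "\<forall>l\<in>{1..k2}. g l \<in> minor_ideal (vars d k1 k2) 2 (block_matrix d k1 k2 l)"
    using h unfolding I_empty_alt by (elim CollectE exE conjE) (rule that)
  note carr = minors_in_poly_ring[OF assms(1)]
  have "poly_eval x f = 0"
  proof (rule Idl_vanish[OF carr(1)])
    show "f \<in> Idl\<^bsub>poly_ring (vars d k1 k2)\<^esub> (minors t (generic_matrix d k1 k2))"
      using f by (simp add: minor_ideal_def)
    fix p assume "p \<in> minors t (generic_matrix d k1 k2)"
    then obtain \<rho> \<gamma> where p: "p = det (mat t t (\<lambda>(a, b). Var (\<rho> a, \<gamma> b)))"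
      unfolding generic_minors_eq[OF assms(1)] by (elim CollectE exE conjE) (rule that)
    have "det (mat t t (\<lambda>(a, b). x (\<rho> a, \<gamma> b))) = 0"
    proof (rule det_low_rank[of _ t "t - 1"])
      fix a b assume "a < t" "b < t"
      thus "mat t t (\<lambda>(a, b). x (\<rho> a, \<gamma> b)) $$ (a, b) = (\<Sum>s<t - 1. u s (\<rho> a) * (v s (snd (\<gamma> b)) * y (\<gamma> b)))"
        using x[of "\<rho> a" "fst (\<gamma> b)" "snd (\<gamma> b)"] by (simp add: sum_distrib_right mult.assoc)
    qed (use assms(2) in auto)
    thus "poly_eval x p = 0" unfolding p poly_eval_minor .
  qed
  moreover have "poly_eval x (g l) = 0" if l: "l \<in> {1..k2}" for l
  proof (rule Idl_vanish[OF carr(2)[OF l]])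
    show "g l \<in> Idl\<^bsub>poly_ring (vars d k1 k2)\<^esub> (minors 2 (block_matrix d k1 k2 l))"
      using g l by (simp add: minor_ideal_def)
    fix p assume "p \<in> minors 2 (block_matrix d k1 k2 l)"
    then obtain \<rho> \<gamma> where p: "p = det (mat 2 2 (\<lambda>(a, b). Var (\<rho> a, (\<gamma> b, l))))"
      unfolding block_minors_eq[OF assms(1) l] by (elim CollectE exE conjE) (rule that)
    have "det (mat 2 2 (\<lambda>(a, b). x (\<rho> a, (\<gamma> b, l)))) = 0"
      by (rule det_low_rank[where n = 2 and r = 1 and u = "\<lambda>_ a. \<Sum>s<t - 1. u s (\<rho> a) * v s l"
          and v = "\<lambda>_ b. y (\<gamma> b, l)"]) (auto simp: x)
    thus "poly_eval x p = 0" unfolding p poly_eval_minor .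
  qed
  hence "poly_eval x (\<Sum>l\<in>A. g l) = 0" if "A \<subseteq> {1..k2}" for A
    using that by (induction A rule: infinite_finite_induct) (auto simp: poly_eval_add)
  ultimately show ?thesis unfolding hfg by (simp add: poly_eval_add)
qed

section \<open>The Groebner basis\<close>

text \<open>
  The heart of the proof. If both kinds of chains were missing, then the weights of \<open>lex_weights\<close>
  and the potentials of \<open>tropical_point\<close> would give points \<open>x \<tau>\<close> of the variety at which the
  leading term of \<open>h\<close> exceeds the sum of all others for a suitable \<open>\<tau>\<close>.
\<close>

lemma chain_in_leading_monomial:
  fixes h :: "var cpoly" and d k1 k2 t :: nat
  assumes dims: "1 \<le> d" "1 \<le> k1" "1 \<le> k2" "1 \<le> t"
    and h: "h \<in> I_empty d k1 k2 t" "h \<noteq> 0"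
  defines "S \<equiv> Poly_Mapping.keys (leading_monomial (lex_less var_gt) h)"
  shows "(\<exists>i j i' j' l. (i, (j, l)) \<in> S \<and> (i', (j', l)) \<in> S \<and> i < i' \<and> j < j') \<or>
    (\<exists>\<rho> \<gamma>. (\<forall>a<t. (\<rho> a, \<gamma> a) \<in> S) \<and>
      (\<forall>a b. a < b \<and> b < t \<longrightarrow> \<rho> a < \<rho> b \<and> snd (\<gamma> a) < snd (\<gamma> b)))"
proof (rule ccontr)
  let ?V = "vars d k1 k2"
  let ?W = "\<lambda>w m. \<Sum>v\<in>?V. (w v :: nat) * Poly_Mapping.lookup m v"
  assume no: "\<not> ?thesis"
  have V: "finite ?V" by (simp add: vars_def)
  have keysV: "Poly_Mapping.keys m \<subseteq> ?V" if "m \<in> Poly_Mapping.keys h" for m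
    using keys_I_empty[OF dims(2) h(1)] that .
  have lm: "leading_monomial (lex_less var_gt) h \<in> Poly_Mapping.keys h"
    and lm_max: "\<And>m'. m' \<in> Poly_Mapping.keys h \<Longrightarrow> m' \<noteq> leading_monomial (lex_less var_gt) h \<Longrightarrow>
      lex_less var_gt m' (leading_monomial (lex_less var_gt) h)"
    using leading_monomial_max[OF h(2)] by auto
  have SV: "S \<subseteq> ?V" unfolding S_def by (rule keysV[OF lm])
  have "\<exists>w :: var \<Rightarrow> nat. (\<forall>u\<in>?V. \<forall>v\<in>?V. var_gt v u \<longrightarrow> 2 * w u \<le> w v) \<and>
    (\<forall>m\<in>Poly_Mapping.keys h. \<forall>m'\<in>Poly_Mapping.keys h. lex_less var_gt m' m \<longrightarrow> ?W w m' < ?W w m)"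
    by (rule lex_weights) (rule var_gt_irrefl var_gt_total V keysV finite_keys | erule (1) var_gt_trans | assumption)+
  then obtain w where "(\<forall>u\<in>?V. \<forall>v\<in>?V. var_gt v u \<longrightarrow> 2 * w u \<le> w v) \<and>
    (\<forall>m\<in>Poly_Mapping.keys h. \<forall>m'\<in>Poly_Mapping.keys h. lex_less var_gt m' m \<longrightarrow> ?W w m' < ?W w m)" ..
  hence w_gt: "\<And>u v. u \<in> ?V \<Longrightarrow> v \<in> ?V \<Longrightarrow> var_gt v u \<Longrightarrow> 2 * w u \<le> w v"
    and w_lex: "\<And>m m'. m \<in> Poly_Mapping.keys h \<Longrightarrow> m' \<in> Poly_Mapping.keys h \<Longrightarrow>
      lex_less var_gt m' m \<Longrightarrow> ?W w m' < ?W w m" by blast+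
  have super: "real (w (r, (j', l'))) - real (w (Suc r, (j', l'))) \<le> real (w (r, (j, l))) - real (w (Suc r, (j, l)))"
    if "1 \<le> r" "r < d" "j \<in> {1..k1}" "j' \<in> {1..k1}" "l \<in> {1..k2}" "l' \<in> {1..k2}"
      "l < l' \<or> l = l' \<and> j < j'" for r j l j' l'
  proof -
    \<comment> \<open>The position \<open>(r, (j, l))\<close> weighs at least twice as much as the entry below it and as every entry to its right.\<close>
    have "2 * w (r, (j', l')) \<le> w (r, (j, l))" "2 * w (Suc r, (j, l)) \<le> w (r, (j, l))"
      by (rule w_gt; use that in \<open>auto simp: vars_def\<close>)+
    thus ?thesis by linarith
  qed
  have block: "j' \<le> j" if "(i, (j, l)) \<in> S" "(i', (j', l)) \<in> S" "i < i'" for i j i' j' l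
    using no that by (meson not_le)
  have no_chain: "\<not> (\<exists>\<rho> \<gamma>. (\<forall>a\<le>t - 1. (\<rho> a, \<gamma> a) \<in> S) \<and>
      (\<forall>a b. a < b \<and> b \<le> t - 1 \<longrightarrow> \<rho> a < \<rho> b \<and> snd (\<gamma> a) < snd (\<gamma> b)))"
  proof -
    have "a \<le> t - 1 \<longleftrightarrow> a < t" for a using dims(4) by linarith
    thus ?thesis using no by simp
  qed
  have "\<exists>(p :: nat \<Rightarrow> nat \<Rightarrow> real) (q :: nat \<Rightarrow> nat \<Rightarrow> real) \<alpha>.
    (\<forall>s i j l. s < t - 1 \<and> (i, (j, l)) \<in> ?V \<longrightarrow> p s i + q s l + \<alpha> (j, l) \<le> real (w (i, (j, l)))) \<and>
    (\<forall>i j l. (i, (j, l)) \<in> S \<longrightarrow> (\<exists>s<t - 1. p s i + q s l + \<alpha> (j, l) = real (w (i, (j, l)))))"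
  proof (rule tropical_point[of d k1 k2 "\<lambda>i c. real (w (i, c))" S "t - 1"])
    show "real (w (r, (j', l'))) - real (w (Suc r, (j', l'))) \<le> real (w (r, (j, l))) - real (w (Suc r, (j, l)))"
      if "1 \<le> r" "r < d" "j \<in> {1..k1}" "j' \<in> {1..k1}" "l \<in> {1..k2}" "l' \<in> {1..k2}"
        "l < l' \<or> l = l' \<and> j < j'" for r j l j' l' using that by (rule super)
    show "j' \<le> j" if "(i, (j, l)) \<in> S" "(i', (j', l)) \<in> S" "i < i'" for i j i' j' l
      using that by (rule block)
  qed (fact dims SV no_chain)+
  then obtain p q :: "nat \<Rightarrow> nat \<Rightarrow> real" and \<alpha> where
    pq: "(\<forall>s i j l. s < t - 1 \<and> (i, (j, l)) \<in> ?V \<longrightarrow> p s i + q s l + \<alpha> (j, l) \<le> real (w (i, (j, l)))) \<and>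
    (\<forall>i j l. (i, (j, l)) \<in> S \<longrightarrow> (\<exists>s<t - 1. p s i + q s l + \<alpha> (j, l) = real (w (i, (j, l)))))"
    by (elim exE) (rule that)
  have le: "p s i + q s l + \<alpha> (j, l) \<le> real (w (i, (j, l)))" if "(i, (j, l)) \<in> ?V" "s < t - 1" for s i j l
    using pq that by simp
  have eq: "\<exists>s<t - 1. p s i + q s l + \<alpha> (j, l) = real (w (i, (j, l)))" if "(i, (j, l)) \<in> S" for i j l
    using pq that by simp
  \<comment> \<open>On \<open>S\<close> one of the summands is exactly \<open>exp (\<tau> * w v)\<close>; no summand exceeds it at any position.\<close>
  define x :: "real \<Rightarrow> var \<Rightarrow> real" where
    "x = (\<lambda>\<tau> (i, (j, l)). \<Sum>s<t - 1. exp (\<tau> * (p s i + q s l + \<alpha> (j, l))))"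
  obtain \<tau> where "poly_eval (\<lambda>v. complex_of_real (x \<tau> v)) h \<noteq> 0"
  proof (rule dominant_term_nonvanishing[OF V keysV lm])
    show "?W w m' < ?W w (leading_monomial (lex_less var_gt) h)"
      if "m' \<in> Poly_Mapping.keys h" "m' \<noteq> leading_monomial (lex_less var_gt) h" for m'
      using w_lex[OF lm that(1) lm_max[OF that]] .
    show "0 \<le> x \<tau> v" for \<tau> v by (cases v rule: prod_cases3) (auto simp: x_def intro: sum_nonneg)
    show "x \<tau> v \<le> real (t - 1) * exp (\<tau> * real (w v))" if "0 \<le> \<tau>" "v \<in> ?V" for \<tau> v
    proof (cases v rule: prod_cases3)
      case (fields i j l)
      have "exp (\<tau> * (p s i + q s l + \<alpha> (j, l))) \<le> exp (\<tau> * real (w v))" if "s < t - 1" for s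
        using le[of i j l s] that \<open>0 \<le> \<tau>\<close> \<open>v \<in> ?V\<close> fields by (simp add: mult_left_mono)
      thus ?thesis
        using sum_bounded_above[of "{..<t - 1}" "\<lambda>s. exp (\<tau> * (p s i + q s l + \<alpha> (j, l)))" "exp (\<tau> * real (w v))"]
        by (simp add: x_def fields)
    qed
    show "exp (\<tau> * real (w v)) \<le> x \<tau> v"
      if "v \<in> Poly_Mapping.keys (leading_monomial (lex_less var_gt) h)" for \<tau> v
    proof (cases v rule: prod_cases3)
      case (fields i j l)
      with that eq[of i j l] obtain s where s: "s < t - 1" "p s i + q s l + \<alpha> (j, l) = real (w v)"
        by (auto simp: S_def)
      have "exp (\<tau> * (p s i + q s l + \<alpha> (j, l))) \<le> (\<Sum>s<t - 1. exp (\<tau> * (p s i + q s l + \<alpha> (j, l))))"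
        by (rule member_le_sum) (use s in auto)
      with s(2) show ?thesis by (simp add: x_def fields)
    qed
  qed
  moreover have "poly_eval (\<lambda>v. complex_of_real (x \<tau> v)) h = 0"
  proof (rule I_empty_vanish[OF dims(2,4) _ h(1)])
    fix i j l
    show "complex_of_real (x \<tau> (i, (j, l))) =
      (\<Sum>s<t - 1. complex_of_real (exp (\<tau> * p s i)) * complex_of_real (exp (\<tau> * q s l))) *
        complex_of_real (exp (\<tau> * \<alpha> (j, l)))"
      by (simp add: x_def sum_distrib_right distrib_left exp_add)
  qed
  ultimately show False by contradiction
qed

text \<open>
  Distinct variables that occur in \<open>m\<close> have a product that divides \<open>m\<close>; the quotient is written as
  a truncated difference of exponents.
\<close>

lemma product_of_vars_divides:
  fixes \<nu> :: "nat \<Rightarrow> 'v"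
  assumes inj: "inj_on \<nu> {..<n}" and keys: "\<And>a. a < n \<Longrightarrow> \<nu> a \<in> Poly_Mapping.keys m"
  shows "m = (m - (\<Sum>a<n. Poly_Mapping.single (\<nu> a) 1)) + (\<Sum>a<n. Poly_Mapping.single (\<nu> a) (1::nat))"
proof (rule poly_mapping_eqI)
  fix v
  have "Poly_Mapping.lookup (\<Sum>a<n. Poly_Mapping.single (\<nu> a) (1::nat)) v = (\<Sum>a<n. if \<nu> a = v then 1 else 0)"
    unfolding lookup_sum by (rule sum.cong) (auto simp: lookup_single when_def)
  also have "\<dots> \<le> Poly_Mapping.lookup m v"
  proof (cases "\<exists>b<n. v = \<nu> b")
    case True
    then obtain b where b: "b < n" "v = \<nu> b" by blast
    have "(\<Sum>a<n. if \<nu> a = v then 1 else 0) = (\<Sum>a<n. if a = b then 1 else (0::nat))"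
      using inj b by (intro sum.cong) (auto dest: inj_onD)
    also have "\<dots> = 1" using b by simp
    also have "1 \<le> Poly_Mapping.lookup m v" using keys[OF b(1)] b(2) by (simp add: in_keys_iff Suc_le_eq)
    finally show ?thesis .
  next
    case False
    hence "(\<Sum>a<n. if \<nu> a = v then 1 else (0::nat)) = 0" by (intro sum.neutral) auto
    thus ?thesis by simp
  qed
  finally show "Poly_Mapping.lookup m v =
    Poly_Mapping.lookup ((m - (\<Sum>a<n. Poly_Mapping.single (\<nu> a) 1)) + (\<Sum>a<n. Poly_Mapping.single (\<nu> a) (1::nat))) v"
    by (simp add: lookup_add lookup_minus)
qed

text \<open>
  A chain in the leading monomial of \<open>h\<close> is the main diagonal of a minor in the generating set,
  whose leading monomial therefore divides that of \<open>h\<close>.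
\<close>

lemma leading_monomial_divisible:
  assumes "1 \<le> d" "1 \<le> k1" "1 \<le> k2" "1 \<le> t" and h: "h \<in> I_empty d k1 k2 t" "h \<noteq> 0"
  shows "\<exists>g\<in>F_empty d k1 k2 t - {0}. leading_monomial (lex_less var_gt) h =
    (leading_monomial (lex_less var_gt) h - leading_monomial (lex_less var_gt) g) + leading_monomial (lex_less var_gt) g"
proof -
  let ?m = "leading_monomial (lex_less var_gt) h"
  have "?m \<in> Poly_Mapping.keys h" using leading_monomial_max[OF h(2)] by blast
  hence V: "Poly_Mapping.keys ?m \<subseteq> vars d k1 k2"
    by (rule keys_I_empty[OF assms(2) h(1)])
  have divides: "\<exists>g\<in>F_empty d k1 k2 t - {0}. ?m = (?m - leading_monomial (lex_less var_gt) g) + leading_monomial (lex_less var_gt) g"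
    if F: "det (mat n n (\<lambda>(a, b). Var (\<rho> a, \<gamma> b))) \<in> F_empty d k1 k2 t"
      and \<rho>: "\<And>a b. a < b \<Longrightarrow> b < n \<Longrightarrow> \<rho> a < \<rho> b"
      and \<gamma>: "\<And>a b. a < b \<Longrightarrow> b < n \<Longrightarrow> col_less (\<gamma> a) (\<gamma> b)"
      and keys: "\<And>a. a < n \<Longrightarrow> (\<rho> a, \<gamma> a) \<in> Poly_Mapping.keys ?m"
    for n and \<rho> :: "nat \<Rightarrow> nat" and \<gamma> :: "nat \<Rightarrow> nat \<times> nat"
  proof -
    have "inj_on (\<lambda>a. (\<rho> a, \<gamma> a)) {..<n}"
      using strict_mono_inj_on_lessThan[of n \<rho>] \<rho> by (auto simp: inj_on_def)
    note divides = product_of_vars_divides[OF this keys]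
    let ?D = "det (mat n n (\<lambda>(a, b). Var (\<rho> a, \<gamma> b)))"
    have "?D \<noteq> 0" by (rule leading_monomial_minor(1)) (fact \<rho> \<gamma>)+
    moreover have lm: "leading_monomial (lex_less var_gt) ?D = (\<Sum>a<n. Poly_Mapping.single (\<rho> a, \<gamma> a) 1)"
      by (rule leading_monomial_minor(2)) (fact \<rho> \<gamma>)+
    moreover have "?m = (?m - leading_monomial (lex_less var_gt) ?D) + leading_monomial (lex_less var_gt) ?D"
      unfolding lm by (rule divides)
    ultimately show ?thesis using F by blast
  qed
  from chain_in_leading_monomial[OF assms] show ?thesis
  proof (elim disjE exE conjE)
    fix i j i' j' l
    assume ij: "(i, (j, l)) \<in> Poly_Mapping.keys ?m" "(i', (j', l)) \<in> Poly_Mapping.keys ?m" "i < i'" "j < j'"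
    have l: "l \<in> {1..k2}" using ij(1) V by (auto simp: vars_def)
    define \<rho> \<gamma> where "\<rho> = (\<lambda>a::nat. if a = 0 then i else i')" and "\<gamma> = (\<lambda>a::nat. if a = 0 then j else j')"
    have "det (mat 2 2 (\<lambda>(a, b). Var (\<rho> a, (\<gamma> b, l)))) \<in> minors 2 (block_matrix d k1 k2 l)"
      unfolding block_minors_eq[OF assms(2) l]
      using ij V by - (rule CollectI, rule exI[of _ \<rho>], rule exI[of _ \<gamma>], auto simp: \<rho>_def \<gamma>_def vars_def)
    hence "det (mat 2 2 (\<lambda>(a, b). Var (\<rho> a, (\<gamma> b, l)))) \<in> F_empty d k1 k2 t"
      using l unfolding F_empty_def by blast
    thus ?thesis
      by (rule divides) (use ij in \<open>auto simp: \<rho>_def \<gamma>_def col_less_def\<close>)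
  next
    fix \<rho> \<gamma>
    assume chain: "\<forall>a<t. (\<rho> a, \<gamma> a) \<in> Poly_Mapping.keys ?m"
      "\<forall>a b. a < b \<and> b < t \<longrightarrow> \<rho> a < \<rho> b \<and> snd (\<gamma> a) < snd (\<gamma> b)"
    hence \<gamma>: "col_less (\<gamma> a) (\<gamma> b)" if "a < b" "b < t" for a b using that by (simp add: col_less_def)
    have in_V: "(\<rho> a, \<gamma> b) \<in> vars d k1 k2" if "a < t" "b < t" for a b
    proof -
      have "(\<rho> a, \<gamma> a) \<in> vars d k1 k2" "(\<rho> b, \<gamma> b) \<in> vars d k1 k2" using chain(1) that V by blast+
      thus ?thesis by (simp add: vars_def)
    qed
    have "det (mat t t (\<lambda>(a, b). Var (\<rho> a, \<gamma> b))) \<in> minors t (generic_matrix d k1 k2)"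
      unfolding generic_minors_eq[OF assms(2)] using chain(2) \<gamma> in_V
      by (intro CollectI exI[of _ \<rho>] exI[of _ \<gamma>]) simp
    hence "det (mat t t (\<lambda>(a, b). Var (\<rho> a, \<gamma> b))) \<in> F_empty d k1 k2 t"
      unfolding F_empty_def by blast
    thus ?thesis by (rule divides) (use chain \<gamma> in auto)
  qed
qed

theorem corollary4p4:
  fixes k1 k2 d t :: nat
  assumes "2 \<le> k1" and "2 \<le> t" and "t \<le> min k2 d"
  shows "is_groebner_basis (vars d k1 k2) (lex_less var_gt)
           (F_empty d k1 k2 t) (I_empty d k1 k2 t)"
proof -
  let ?R = "poly_ring (vars d k1 k2)"
  let ?lm = "\<lambda>f. Poly_Mapping.single (leading_monomial (lex_less var_gt) f) (1::complex)"
  have k1: "1 \<le> k1" and dims: "1 \<le> d" "1 \<le> k2" "1 \<le> t" using assms by auto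
  have carr: "?lm f \<in> carrier ?R" if "f \<in> I_empty d k1 k2 t" "f \<noteq> 0" for f
    using keys_I_empty[OF k1 that(1)] leading_monomial_max[OF that(2)]
    by (simp add: poly_ring_simps)
  note sub = F_empty_subset_I_empty[OF k1, of d k2 t]
  have gens: "?lm ` (F_empty d k1 k2 t - {0}) \<subseteq> carrier ?R" "?lm ` (I_empty d k1 k2 t - {0}) \<subseteq> carrier ?R"
    using carr sub by blast+
  note ideal_F = ring.genideal_ideal[OF ring_poly_ring gens(1)]
  have "Idl\<^bsub>?R\<^esub> (?lm ` (F_empty d k1 k2 t - {0})) \<subseteq> Idl\<^bsub>?R\<^esub> (?lm ` (I_empty d k1 k2 t - {0}))"
    by (rule ring.genideal_minimal[OF ring_poly_ring ring.genideal_ideal[OF ring_poly_ring gens(2)]])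
      (use ring.genideal_self[OF ring_poly_ring gens(2)] sub in blast)
  moreover have "Idl\<^bsub>?R\<^esub> (?lm ` (I_empty d k1 k2 t - {0})) \<subseteq> Idl\<^bsub>?R\<^esub> (?lm ` (F_empty d k1 k2 t - {0}))"
  proof (rule ring.genideal_minimal[OF ring_poly_ring ideal_F], rule image_subsetI)
    fix h assume "h \<in> I_empty d k1 k2 t - {0}"
    hence h: "h \<in> I_empty d k1 k2 t" "h \<noteq> 0" by auto
    let ?m = "leading_monomial (lex_less var_gt) h"
    obtain g where g: "g \<in> F_empty d k1 k2 t - {0}"
      and m: "?m = (?m - leading_monomial (lex_less var_gt) g) + leading_monomial (lex_less var_gt) g"
      using leading_monomial_divisible[OF dims(1) k1 dims(2,3) h] by blast
    let ?c = "Poly_Mapping.single (?m - leading_monomial (lex_less var_gt) g) (1::complex)"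
    have "Poly_Mapping.keys (?m - leading_monomial (lex_less var_gt) g) \<subseteq> Poly_Mapping.keys ?m"
      by (auto simp: in_keys_iff lookup_minus)
    with carr[OF h] have c: "?c \<in> carrier ?R" by (auto simp: poly_ring_simps)
    have "?lm g \<in> Idl\<^bsub>?R\<^esub> (?lm ` (F_empty d k1 k2 t - {0}))"
      using ring.genideal_self[OF ring_poly_ring gens(1)] g by blast
    from ideal.I_l_closed[OF ideal_F this c]
    have "?c * ?lm g \<in> Idl\<^bsub>?R\<^esub> (?lm ` (F_empty d k1 k2 t - {0}))" by (simp add: poly_ring_simps)
    moreover have "?c * ?lm g = ?lm h" by (subst m) (simp add: mult_single)
    ultimately show "?lm h \<in> Idl\<^bsub>?R\<^esub> (?lm ` (F_empty d k1 k2 t - {0}))" by simp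
  qed
  moreover have "finite (F_empty d k1 k2 t)" unfolding F_empty_def by (simp add: finite_minors)
  ultimately show ?thesis unfolding is_groebner_basis_def initial_ideal_def using sub by blast
qed

end
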